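(* Let $E$ be a Banach lattice with an order continuous norm. Then the following assertions are equivalent: (1) Each positive almost L-weakly compact operator $T$ from $E$ to $E$ is semi-compact. (2) The norm of the dual $E'$ is order continuous.
   Context: All Banach spaces and Banach lattices are real, and operators are continuous linear maps. $B_E$ denotes the closed unit ball of $E$, $E_+$ the positive cone of $E$, and $E'$ the norm dual of $E$ (a Banach lattice). An operator $T:X\to E$ from a Banach space to a Banach lattice is semi-compact if for each $\varepsilon>0$ there exists $u\in E_+$ such that $T(B_X)\subset[-u,u]+\varepsilon B_E$. A nonempty norm bounded subset $A$ of a Banach lattice $E$ is L-weakly compact if $\|y_n\|\to 0$ for every disjoint sequence $(y_n)$ contained in the solid hull $\{y\in E: |y|\le |a| \text{ for some } a\in A\}$ of $A$. An operator $T$ from a Banach space $X$ into a Banach lattice $E$ is almost L-weakly compact if $T$ maps relatively weakly compact subsets of $X$ onto L-weakly compact subsets of $E$. The norm of a Banach lattice $G$ is order continuous if $\|x_\alpha\|\downarrow 0$ for every net $(x_\alpha)$ in $G$ with $x_\alpha\downarrow 0$. *)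

theory Defs
  imports "HOL-Analysis.Analysis" "HOL-Library.Lattice_Algebras"
begin

class banach_lattice = banach + ordered_real_vector + lattice_ab_group_add_abs +
  assumes norm_le_norm_if_abs_le: "\<bar>x\<bar> \<le> \<bar>y\<bar> \<Longrightarrow> norm x \<le> norm y"

instance real :: banach_lattice
  by standard simp


text \<open>
  The usual operator order: \<open>S \<le> T\<close> iff \<open>S x \<le> T x\<close> for all \<open>x \<ge> 0\<close>. In particular \<open>0 \<le> T\<close>
  says that \<open>T\<close> is a positive operator, and on \<open>'a \<Rightarrow>\<^sub>L real\<close>, which carries the operator norm,
  this is the order of the Banach lattice dual.
\<close>

instantiation blinfun :: (banach_lattice, "{real_normed_vector, ordered_ab_group_add}") order
begin

definition less_eq_blinfun :: "('a \<Rightarrow>\<^sub>L 'b) \<Rightarrow> ('a \<Rightarrow>\<^sub>L 'b) \<Rightarrow> bool"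
  where "less_eq_blinfun S T \<longleftrightarrow> (\<forall>x\<ge>0. blinfun_apply S x \<le> blinfun_apply T x)"

definition less_blinfun :: "('a \<Rightarrow>\<^sub>L 'b) \<Rightarrow> ('a \<Rightarrow>\<^sub>L 'b) \<Rightarrow> bool"
  where "less_blinfun S T \<longleftrightarrow> S \<le> T \<and> \<not> T \<le> S"

instance
proof
  fix S T U :: "'a \<Rightarrow>\<^sub>L 'b"
  show "(S < T) = (S \<le> T \<and> \<not> T \<le> S)" by (rule less_blinfun_def)
  show "S \<le> S" by (simp add: less_eq_blinfun_def)
  show "S \<le> U" if "S \<le> T" "T \<le> U"
    using that unfolding less_eq_blinfun_def by (meson order_trans)
  show "S = T" if "S \<le> T" "T \<le> S"
  proof (rule blinfun_eqI)
    fix x :: 'a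
    have eq: "blinfun_apply S y = blinfun_apply T y" if "0 \<le> y" for y
      using \<open>S \<le> T\<close> \<open>T \<le> S\<close> that unfolding less_eq_blinfun_def by (meson order_antisym)
    have x: "x = pprt x - (- nprt x)"
      using prts[of x] by simp
    have "blinfun_apply S x = blinfun_apply S (pprt x) - blinfun_apply S (- nprt x)"
      by (subst x) (simp only: blinfun.diff_right)
    also have "\<dots> = blinfun_apply T (pprt x) - blinfun_apply T (- nprt x)"
      by (simp only: eq zero_le_pprt neg_0_le_iff_le nprt_le_zero)
    also have "\<dots> = blinfun_apply T x"
      by (subst (3) x) (simp only: blinfun.diff_right)
    finally show "blinfun_apply S x = blinfun_apply T x" .
  qed
qed

end


definition directed_set :: "'i set \<Rightarrow> ('i \<Rightarrow> 'i \<Rightarrow> bool) \<Rightarrow> bool"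
  where "directed_set I r \<longleftrightarrow> I \<noteq> {} \<and> reflp_on I r \<and> transp_on I r \<and>
    (\<forall>i\<in>I. \<forall>j\<in>I. \<exists>k\<in>I. r i k \<and> r j k)"

text \<open>\<open>x\<^sub>\<alpha> \<down> 0\<close>: the net is decreasing and its infimum exists and is \<open>0\<close>.\<close>

definition decreases_to_0 :: "'i set \<Rightarrow> ('i \<Rightarrow> 'i \<Rightarrow> bool) \<Rightarrow> ('i \<Rightarrow> 'a::{order,zero}) \<Rightarrow> bool"
  where "decreases_to_0 I r x \<longleftrightarrow>
    (\<forall>i\<in>I. \<forall>j\<in>I. r i j \<longrightarrow> x j \<le> x i) \<and>
    (\<forall>i\<in>I. 0 \<le> x i) \<and> (\<forall>z. (\<forall>i\<in>I. z \<le> x i) \<longrightarrow> z \<le> 0)"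

text \<open>
  A definition cannot quantify over the type of the indices, so the index sets range over subsets of
  \<open>'a\<close>, carrying an arbitrary directed preorder. Lemma \<open>order_continuous_norm_net\<close> shows that this
  covers nets over arbitrary index types.
\<close>

definition order_continuous_norm :: "'a::{real_normed_vector,order} itself \<Rightarrow> bool"
  where "order_continuous_norm _ \<longleftrightarrow>
    (\<forall>(I :: 'a set) r (x :: 'a \<Rightarrow> 'a). directed_set I r \<longrightarrow> decreases_to_0 I r x \<longrightarrow>
      decreases_to_0 I r (\<lambda>i. norm (x i)))"

lemma order_continuous_norm_net:
  fixes x :: "'i \<Rightarrow> 'a::{real_normed_vector,order}"
  assumes "order_continuous_norm TYPE('a)" "directed_set I r" "decreases_to_0 I r x"
  shows "decreases_to_0 I r (\<lambda>i. norm (x i))"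
proof -
  have "directed_set (x ` I) (\<lambda>a b. b \<le> a)"
    unfolding directed_set_def
  proof (intro conjI)
    show "\<forall>a\<in>x ` I. \<forall>b\<in>x ` I. \<exists>c\<in>x ` I. c \<le> a \<and> c \<le> b"
      using assms(2,3) unfolding directed_set_def decreases_to_0_def by (simp, meson)
  qed (use assms(2) in \<open>auto simp: directed_set_def reflp_on_def transp_on_def\<close>)
  moreover have "decreases_to_0 (x ` I) (\<lambda>a b. b \<le> a) (\<lambda>a. a)"
    using assms(3) unfolding decreases_to_0_def by simp
  ultimately have "decreases_to_0 (x ` I) (\<lambda>a b. b \<le> a) norm"
    using assms(1) unfolding order_continuous_norm_def by blast
  then show ?thesis
    using assms(3) unfolding decreases_to_0_def by simp
qed


definition semi_compact :: "('a::banach \<Rightarrow>\<^sub>L 'b::banach_lattice) \<Rightarrow> bool"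
  where "semi_compact T \<longleftrightarrow> (\<forall>\<epsilon>>0. \<exists>u\<ge>0.
    blinfun_apply T ` cball 0 1 \<subseteq> {y + \<epsilon> *\<^sub>R b | y b. y \<in> {- u..u} \<and> b \<in> cball 0 1})"

definition solid_hull :: "'a::banach_lattice set \<Rightarrow> 'a set"
  where "solid_hull A = {y. \<exists>a\<in>A. \<bar>y\<bar> \<le> \<bar>a\<bar>}"

definition disjoint_seq :: "(nat \<Rightarrow> 'a::banach_lattice) \<Rightarrow> bool"
  where "disjoint_seq y \<longleftrightarrow> (\<forall>m n. m \<noteq> n \<longrightarrow> inf \<bar>y m\<bar> \<bar>y n\<bar> = 0)"

definition L_weakly_compact :: "'a::banach_lattice set \<Rightarrow> bool"
  where "L_weakly_compact A \<longleftrightarrow> A \<noteq> {} \<and> bounded A \<and>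
    (\<forall>y. disjoint_seq y \<longrightarrow> range y \<subseteq> solid_hull A \<longrightarrow> (\<lambda>n. norm (y n)) \<longlonglongrightarrow> 0)"

definition weak_topology :: "'a::real_normed_vector topology"
  where "weak_topology = topology_generated_by
    {blinfun_apply f -` U | (f :: 'a \<Rightarrow>\<^sub>L real) U. open U}"

definition relatively_weakly_compact :: "'a::real_normed_vector set \<Rightarrow> bool"
  where "relatively_weakly_compact A \<longleftrightarrow> compactin weak_topology (weak_topology closure_of A)"

text \<open>
  The empty set is relatively weakly compact but, by definition, not L-weakly compact, so it has to
  be excluded here.
\<close>

definition almost_L_weakly_compact :: "('a::banach \<Rightarrow>\<^sub>L 'b::banach_lattice) \<Rightarrow> bool"
  where "almost_L_weakly_compact T \<longleftrightarrow>
    (\<forall>A. A \<noteq> {} \<longrightarrow> relatively_weakly_compact A \<longrightarrow> L_weakly_compact (blinfun_apply T ` A))"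

end

theory Submission
  imports Defs
begin

text \<open>
  Both implications rest on one construction. Call a positive operator \<open>T\<close> on \<open>E\<close> order bounded up to
  \<open>\<epsilon>\<close> if some \<open>u \<ge> 0\<close> satisfies \<open>\<parallel>T (x - u)\<^sup>+\<parallel> \<le> \<epsilon>\<close> for all positive \<open>x\<close> in the unit ball. If this
  fails for some \<open>\<epsilon> > 0\<close>, the unit ball contains a positive disjoint sequence \<open>w\<^sub>n\<close> with
  \<open>\<parallel>T w\<^sub>n\<parallel> > \<epsilon> / 2\<close> (\<open>disjoint_sequence_if_not_order_bounded\<close>). A functional is such an operator,
  too, with range \<open>\<real>\<close>.

  Let the norm of \<open>E'\<close> be order continuous and let \<open>T\<close> be positive and almost L-weakly compact but not
  semi-compact. Then there is such a sequence \<open>w\<^sub>n\<close> for \<open>T\<close>. A positive functional \<open>f\<close> splits off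
  components \<open>g\<^sub>n\<close> along the ideals generated by the \<open>w\<^sub>n\<close>, and the tails of \<open>\<Sum>g\<^sub>n \<le> f\<close> decrease to
  \<open>0\<close>, hence in norm. So \<open>w\<^sub>n\<close> is weakly null
  (\<open>dual_order_continuous_disjoint_weakly_null\<close>), and in particular relatively weakly compact. Thus
  \<open>T w\<^sub>n\<close> is a positive weakly null sequence that is L-weakly compact, and such a sequence is norm
  null if the norm of \<open>E\<close> is order continuous (\<open>positive_weakly_null_L_weakly_compact_null\<close>). This
  contradicts \<open>\<parallel>T w\<^sub>n\<parallel> > \<epsilon> / 2\<close>. Norming functionals come from the Hahn--Banach theorem.

  Let the norm of \<open>E'\<close> not be order continuous. Then some positive functional \<open>f\<close> is not order bounded
  up to some \<open>\<epsilon>\<close> (\<open>dual_order_continuous_if_order_bounded\<close>), so \<open>f(w\<^sub>n) > \<epsilon> / 2\<close> for a positive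
  disjoint sequence in the unit ball. With the components \<open>g\<^sub>n\<close> of \<open>f\<close>, the operator
  \<open>T y = (\<Sum>n. g\<^sub>n(y) w\<^sub>n)\<close> is positive and factors through \<open>\<ell>\<^sup>1\<close>. The Schur property of \<open>\<ell>\<^sup>1\<close>, in
  the form of \<open>dominated_functionals_uniformly_small_tails\<close>, makes it almost L-weakly compact. It is not
  semi-compact, because \<open>T w\<^sub>n\<close> dominates a fixed multiple of \<open>w\<^sub>n\<close>, while disjoint sequences in an order
  interval are norm null and \<open>\<parallel>w\<^sub>n\<parallel>\<close> is bounded below.
\<close>

section \<open>Banach lattice arithmetic\<close>

lemma pprt_diff_disjoint:
  fixes x y :: "'a::lattice_ab_group_add"
  shows "inf (pprt (x - y)) (pprt (y - x)) = 0"
proof -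
  have "pprt (x - y) = x - inf x y"
    unfolding pprt_def
    by (simp add: add_sup_distrib_left sup_commute)
  moreover have "pprt (y - x) = y - inf x y"
    unfolding pprt_def
    by (simp add: add_sup_distrib_left)
  ultimately have "inf (pprt (x - y)) (pprt (y - x)) = inf (x + - inf x y) (y + - inf x y)"
    by simp
  also have "\<dots> = inf x y + - inf x y"
    by (simp only: add_inf_distrib_right)
  finally show ?thesis by (simp only: add.right_inverse)
qed

lemma inf_eq_0_mono:
  fixes a b :: "'a::lattice_ab_group_add"
  assumes "inf x y = 0" "0 \<le> a" "0 \<le> b" "a \<le> x" "b \<le> y"
  shows "inf a b = 0"
  using assms by (metis inf_mono inf_greatest order_antisym)

lemma inf_add_le:
  fixes a b c :: "'a::lattice_ab_group_add"
  assumes "0 \<le> a" "0 \<le> b" "0 \<le> c"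
  shows "inf (a + b) c \<le> inf a c + inf b c"
proof -
  have *: "inf a c + inf b c = inf (inf (a + b) (a + c)) (inf (c + b) (c + c))"
    by (simp only: add_inf_distrib_right add_inf_distrib_left) (simp add: inf.assoc inf.left_commute)
  show ?thesis unfolding *
    using assms by (auto intro!: le_infI intro: le_infI1 le_infI2 add_increasing add_increasing2)
qed

lemma scaleR_inf:
  fixes x y :: "'a::banach_lattice"
  assumes "0 < c"
  shows "c *\<^sub>R inf x y = inf (c *\<^sub>R x) (c *\<^sub>R y)"
proof (rule order_antisym)
  show "c *\<^sub>R inf x y \<le> inf (c *\<^sub>R x) (c *\<^sub>R y)"
    using assms by (simp add: scaleR_left_mono)
  have "inverse c *\<^sub>R inf (c *\<^sub>R x) (c *\<^sub>R y) \<le> inverse c *\<^sub>R (c *\<^sub>R x)"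
    "inverse c *\<^sub>R inf (c *\<^sub>R x) (c *\<^sub>R y) \<le> inverse c *\<^sub>R (c *\<^sub>R y)"
    using assms by (intro scaleR_left_mono; simp)+
  then have "inverse c *\<^sub>R inf (c *\<^sub>R x) (c *\<^sub>R y) \<le> inf x y"
    using assms by simp
  then have "c *\<^sub>R (inverse c *\<^sub>R inf (c *\<^sub>R x) (c *\<^sub>R y)) \<le> c *\<^sub>R inf x y"
    using assms by (intro scaleR_left_mono) auto
  then show "inf (c *\<^sub>R x) (c *\<^sub>R y) \<le> c *\<^sub>R inf x y"
    using assms by simp
qed

lemma scaleR_pprt:
  fixes x :: "'a::banach_lattice"
  assumes "0 < c"
  shows "c *\<^sub>R pprt x = pprt (c *\<^sub>R x)"
  using scaleR_inf[OF assms, of "-x" 0]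
  by (metis nprt_def pprt_neg minus_minus scaleR_minus_right scaleR_zero_right)

lemma abs_scaleR_lattice:
  fixes x :: "'a::banach_lattice"
  shows "\<bar>c *\<^sub>R x\<bar> = \<bar>c\<bar> *\<^sub>R \<bar>x\<bar>"
proof -
  have pos: "\<bar>c *\<^sub>R x\<bar> = c *\<^sub>R \<bar>x\<bar>" if "0 < c" for c
    using scaleR_pprt[OF that, of x] scaleR_pprt[OF that, of "-x"]
    by (simp add: abs_prts pprt_neg scaleR_diff_right)
  consider "c = 0" | "0 < c" | "c < 0" by linarith
  then show ?thesis
  proof cases
    case 3
    then show ?thesis
      using pos[of "- c"] by simp
  qed (use pos in auto)
qed

lemma abs_sum_lattice_le:
  fixes x :: "'i \<Rightarrow> 'a::banach_lattice"
  shows "\<bar>\<Sum>i\<in>I. x i\<bar> \<le> (\<Sum>i\<in>I. \<bar>x i\<bar>)"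
proof (induction I rule: infinite_finite_induct)
  case (insert i I)
  have "\<bar>x i + sum x I\<bar> \<le> \<bar>x i\<bar> + \<bar>sum x I\<bar>" by (rule abs_triangle_ineq)
  also have "\<dots> \<le> \<bar>x i\<bar> + (\<Sum>i\<in>I. \<bar>x i\<bar>)" by (rule add_left_mono[OF insert.IH])
  finally show ?case using insert.hyps by simp
qed simp_all

text \<open>Riesz decomposition; the first summand is \<open>x\<close> cut off at \<open>\<plusminus>u\<close>.\<close>

lemma riesz_decomposition:
  fixes x u v :: "'a::banach_lattice"
  assumes "0 \<le> u" "0 \<le> v" "\<bar>x\<bar> \<le> u + v"
  obtains a b where "x = a + b" "\<bar>a\<bar> \<le> u" "\<bar>b\<bar> \<le> v"
proof
  have x: "x \<le> u + v" "- x \<le> u + v"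
    using assms(3) by (simp_all add: abs_le_iff)
  define a where "a = sup (- u) (inf u x)"
  show "x = a + (x - a)" by simp
  have "- u \<le> u" using assms(1) by (metis neg_le_0_iff_le order_trans)
  then have "- u \<le> a" "a \<le> u"
    unfolding a_def by (auto intro: le_infI1)
  then show "\<bar>a\<bar> \<le> u" by (simp add: abs_le_iff minus_le_iff)
  have "a \<le> x + v"
    unfolding a_def
  proof (rule le_supI)
    show "- u \<le> x + v"
      using x(2) by (metis add.commute diff_le_eq minus_diff_eq minus_le_iff uminus_add_conv_diff)
    show "inf u x \<le> x + v"
      using assms(2) by (intro le_infI2) simp
  qed
  moreover have "x - v \<le> a"
  proof -
    have "x - v \<le> inf u x"
      using x assms(2) by (auto simp: algebra_simps)
    then show ?thesis unfolding a_def by (rule le_supI2)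
  qed
  ultimately show "\<bar>x - a\<bar> \<le> v"
    by (simp add: abs_le_iff algebra_simps)
qed

lemma norm_abs_lattice [simp]:
  fixes x :: "'a::banach_lattice"
  shows "norm \<bar>x\<bar> = norm x"
  by (intro order_antisym norm_le_norm_if_abs_le) auto

lemma norm_mono_nonneg:
  fixes x y :: "'a::banach_lattice"
  assumes "0 \<le> x" "x \<le> y"
  shows "norm x \<le> norm y"
  using assms by (intro norm_le_norm_if_abs_le) (simp add: order_trans[OF assms])

lemma pprt_le_abs: "pprt x \<le> \<bar>x :: 'a::banach_lattice\<bar>"
  unfolding pprt_def by (simp add: abs_ge_self)

lemma norm_pprt_le: "norm (pprt x) \<le> norm (x :: 'a::banach_lattice)"
  using norm_mono_nonneg[OF zero_le_pprt pprt_le_abs[of x]] by simp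

lemma le_add_pprt_diff: "x \<le> u + pprt (x - u :: 'a::banach_lattice)"
proof -
  have "x - u \<le> pprt (x - u)" by (simp add: pprt_def)
  then show ?thesis by (simp add: algebra_simps)
qed

lemma closed_nonneg: "closed {x :: 'a::banach_lattice. 0 \<le> x}"
  unfolding closed_sequential_limits
proof (intro allI impI)
  fix s and l :: 'a
  assume *: "(\<forall>n. s n \<in> {x. 0 \<le> x}) \<and> s \<longlonglongrightarrow> l"
  have "norm (pprt (- l)) \<le> norm (s n - l)" for n
  proof -
    have "pprt (- l) \<le> \<bar>s n - l\<bar>"
      using * by (auto simp: pprt_def intro: order_trans[OF _ abs_ge_self])
    then show ?thesis
      using norm_mono_nonneg[OF zero_le_pprt] by fastforce
  qed
  moreover have "(\<lambda>n. norm (s n - l)) \<longlonglongrightarrow> 0"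
    using * by (simp add: LIM_zero tendsto_norm_zero)
  ultimately have "norm (pprt (- l)) \<le> 0"
    by (intro LIMSEQ_le_const) auto
  then show "l \<in> {x. 0 \<le> x}"
    using le_zero_iff_zero_pprt[of "- l"] by simp
qed

lemma lattice_LIMSEQ_le:
  fixes s t :: "nat \<Rightarrow> 'a::banach_lattice"
  assumes "s \<longlonglongrightarrow> l" "t \<longlonglongrightarrow> m" "\<And>n. N \<le> n \<Longrightarrow> s n \<le> t n"
  shows "l \<le> m"
proof -
  have "(\<lambda>n. t (n + N) - s (n + N)) \<longlonglongrightarrow> m - l"
    using assms(1,2) by (intro tendsto_diff LIMSEQ_ignore_initial_segment)
  then have "m - l \<in> {x. 0 \<le> x}"
    using closed_nonneg assms(3) unfolding closed_sequential_limits
    by (metis (no_types, lifting) diff_ge_0_iff_ge le_add2 mem_Collect_eq)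
  then show ?thesis by simp
qed

lemma lattice_suminf_nonneg:
  fixes s :: "nat \<Rightarrow> 'a::banach_lattice"
  assumes "summable s" "\<And>n. 0 \<le> s n"
  shows "0 \<le> suminf s"
  using assms by (intro lattice_LIMSEQ_le[OF tendsto_const summable_LIMSEQ[OF assms(1)], of 0])
    (simp add: sum_nonneg)

lemma lattice_member_le_suminf:
  fixes s :: "nat \<Rightarrow> 'a::banach_lattice"
  assumes "summable s" "\<And>n. 0 \<le> s n"
  shows "s k \<le> suminf s"
proof (rule lattice_LIMSEQ_le[OF tendsto_const summable_LIMSEQ[OF assms(1)], of "Suc k"])
  show "s k \<le> sum s {..<n}" if "Suc k \<le> n" for n
    using that assms(2) sum_mono2[of "{..<n}" "{k}" s] by auto
qed

lemma sum_disjoint_le: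
  fixes a :: "'i \<Rightarrow> 'a::banach_lattice"
  assumes "finite I" "0 \<le> y" "\<And>i. i \<in> I \<Longrightarrow> 0 \<le> a i \<and> a i \<le> y"
    and "\<And>i j. i \<in> I \<Longrightarrow> j \<in> I \<Longrightarrow> i \<noteq> j \<Longrightarrow> inf (a i) (a j) = 0"
  shows "(\<Sum>i\<in>I. a i) \<le> y"
proof -
  have "(\<Sum>i\<in>I. a i) \<le> y \<and> (\<forall>c\<ge>0. (\<forall>i\<in>I. inf (a i) c = 0) \<longrightarrow> inf (\<Sum>i\<in>I. a i) c = 0)"
    using assms
  proof (induction I rule: finite_induct)
    case empty
    then show ?case by (auto simp: inf_absorb1)
  next
    case (insert i I)
    have I0: "0 \<le> (\<Sum>j\<in>I. a j)" using insert by (intro sum_nonneg) auto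
    have ai: "0 \<le> a i" "a i \<le> y" using insert by auto
    have "inf (\<Sum>j\<in>I. a j) (a i) = 0"
      using insert by (metis insert_iff)
    then have "sup (\<Sum>j\<in>I. a j) (a i) = (\<Sum>j\<in>I. a j) + a i"
      using add_eq_inf_sup[of "\<Sum>j\<in>I. a j" "a i"] by simp
    moreover have "sup (\<Sum>j\<in>I. a j) (a i) \<le> y"
      using insert ai by auto
    ultimately have "(\<Sum>j\<in>I. a j) + a i \<le> y" by simp
    moreover have "inf (a i + (\<Sum>j\<in>I. a j)) c = 0"
      if c: "0 \<le> c" "\<forall>j\<in>insert i I. inf (a j) c = 0" for c
    proof (rule order_antisym)
      have "inf (a i + (\<Sum>j\<in>I. a j)) c \<le> inf (a i) c + inf (\<Sum>j\<in>I. a j) c"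
        by (intro inf_add_le I0 ai c)
      also have "\<dots> = 0" using insert c by auto
      finally show "inf (a i + (\<Sum>j\<in>I. a j)) c \<le> 0" .
      show "0 \<le> inf (a i + (\<Sum>j\<in>I. a j)) c" using I0 ai c by simp
    qed
    ultimately show ?case using insert.hyps by (auto simp: add.commute)
  qed
  then show ?thesis ..
qed

text \<open>
  The device behind every disjoint sequence below. If \<open>x\<close> and \<open>y\<close> are any elements, then
  \<open>(x - M y)\<^sup>+\<close> and \<open>(M y - x)\<^sup>+\<close> are disjoint, so subtracting a large multiple
  on one side costs only a small multiple on the other.
\<close>

lemma disjoint_if_le_pprt_diff:
  fixes a b x y :: "'a::banach_lattice"
  assumes "1 \<le> M" "0 \<le> a" "0 \<le> b" "a \<le> pprt (x - M *\<^sub>R y)" "b \<le> pprt (y - inverse M *\<^sub>R x)"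
  shows "inf a b = 0"
proof (rule inf_eq_0_mono[OF pprt_diff_disjoint])
  show "a \<le> pprt (x - M *\<^sub>R y)" by fact
  have "b \<le> M *\<^sub>R b"
    using scaleR_right_mono[OF assms(1,3)] by simp
  also have "\<dots> \<le> M *\<^sub>R pprt (y - inverse M *\<^sub>R x)"
    using assms by (intro scaleR_left_mono) auto
  also have "\<dots> = pprt (M *\<^sub>R y - x)"
    using assms(1) by (simp add: scaleR_pprt scaleR_diff_right)
  finally show "b \<le> pprt (M *\<^sub>R y - x)" .
qed (use assms in auto)

section \<open>Order continuity of the norm\<close>

text \<open>
  If \<open>y\<close> ranges over the lower bounds of a decreasing sequence, then the differences
  \<open>x\<^sub>n - y\<close> decrease to \<open>0\<close>: adding a lower bound of the differences to a lower bound of the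
  sequence gives a lower bound again, and this can be iterated. By order continuity some difference
  \<open>x\<^sub>n - y\<close> has small norm, and it dominates \<open>x\<^sub>n - x\<^sub>m\<close> for all \<open>m \<ge> n\<close>, so the sequence is Cauchy.
\<close>

lemma order_continuous_decreasing_convergent:
  fixes x :: "nat \<Rightarrow> 'a::banach_lattice"
  assumes ocn: "order_continuous_norm TYPE('a)"
    and dec: "decseq x" and pos: "\<And>n. 0 \<le> x n"
  obtains l where "x \<longlonglongrightarrow> l" "0 \<le> l" "\<And>n. l \<le> x n"
proof -
  define L where "L = {y. \<forall>n. y \<le> x n}"
  define I where "I = (UNIV :: nat set) \<times> L"
  define r where "r = (\<lambda>(p :: nat \<times> 'a) q. fst p \<le> fst q \<and> snd p \<le> snd q)"
  have "0 \<in> L" using pos by (simp add: L_def)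
  have dir: "directed_set I r"
    unfolding directed_set_def
  proof (intro conjI ballI)
    show "I \<noteq> {}" using \<open>0 \<in> L\<close> by (auto simp: I_def)
    fix p q assume "p \<in> I" "q \<in> I"
    then have "(max (fst p) (fst q), sup (snd p) (snd q)) \<in> I"
      by (auto simp: I_def L_def)
    then show "\<exists>k\<in>I. r p k \<and> r q k"
      by (rule rev_bexI) (auto simp: r_def)
  qed (auto simp: r_def reflp_on_def transp_on_def)
  have "z \<le> 0" if z: "\<forall>p\<in>I. z \<le> x (fst p) - snd p" for z
  proof -
    have step: "y + z \<le> x n" if "y \<in> L" for y n
      using z that by (auto simp: I_def algebra_simps)
    have kz: "real k *\<^sub>R z \<in> L" for k
    proof (induction k)
      case 0
      then show ?case using \<open>0 \<in> L\<close> by simp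
    next
      case (Suc k)
      then show ?case using step[of "real k *\<^sub>R z"] by (auto simp: L_def algebra_simps)
    qed
    have "real k * norm (pprt z) \<le> norm (x 0)" for k
    proof (cases "k = 0")
      case False
      have "real k *\<^sub>R pprt z = pprt (real k *\<^sub>R z)"
        using False by (simp add: scaleR_pprt)
      also have "\<dots> \<le> pprt (x 0)" using kz[of k] by (intro pprt_mono) (auto simp: L_def)
      also have "\<dots> = x 0" using pos by simp
      finally have "norm (real k *\<^sub>R pprt z) \<le> norm (x 0)"
        by (intro norm_mono_nonneg) (simp_all add: scaleR_nonneg_nonneg)
      then show ?thesis by simp
    qed simp
    then have "norm (pprt z) \<le> 0"
      by (metis ex_less_of_nat_mult not_le)
    then show ?thesis by (simp add: le_zero_iff_zero_pprt)
  qed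
  then have "decreases_to_0 I r (\<lambda>p. x (fst p) - snd p)"
    using dec unfolding decreases_to_0_def
    by (auto simp: I_def L_def r_def decseq_def intro: diff_mono)
  from order_continuous_norm_net[OF ocn dir this]
  have small: "\<exists>p\<in>I. norm (x (fst p) - snd p) < e" if "0 < e" for e
    using that unfolding decreases_to_0_def by (meson not_le)
  have "Cauchy x"
  proof (rule metric_CauchyI)
    fix e :: real assume "0 < e"
    then obtain N y where N: "\<And>n. y \<le> x n" "norm (x N - y) < e / 2"
      using small[of "e / 2"] by (auto simp: I_def L_def)
    have *: "norm (x N - x n) < e / 2" if "N \<le> n" for n
    proof -
      have "norm (x N - x n) \<le> norm (x N - y)"
        using N(1) decseqD[OF dec that] by (intro norm_mono_nonneg) (auto intro: diff_mono)
      then show ?thesis using N(2) by simp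
    qed
    have "dist (x m) (x n) < e" if "N \<le> m" "N \<le> n" for m n
      using dist_triangle_half_r[of "x N" "x m" e "x n"] *[OF that(1)] *[OF that(2)]
      by (simp add: dist_norm)
    then show "\<exists>M. \<forall>m\<ge>M. \<forall>n\<ge>M. dist (x m) (x n) < e" by blast
  qed
  then obtain l where l: "x \<longlonglongrightarrow> l" using convergent_eq_Cauchy by blast
  show thesis
  proof
    show "x \<longlonglongrightarrow> l" by fact
    show "0 \<le> l" using pos by (intro lattice_LIMSEQ_le[OF tendsto_const l, of 0]) auto
    show "l \<le> x n" for n
      using dec by (intro lattice_LIMSEQ_le[OF l tendsto_const, of n]) (auto simp: decseq_def)
  qed
qed

text \<open>The partial sums of a disjoint sequence below \<open>u\<close> increase and stay below \<open>u\<close>.\<close>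

lemma order_continuous_disjoint_null:
  fixes x :: "nat \<Rightarrow> 'a::banach_lattice"
  assumes ocn: "order_continuous_norm TYPE('a)"
    and disj: "\<And>m n. m \<noteq> n \<Longrightarrow> inf (x m) (x n) = 0"
    and x: "\<And>n. 0 \<le> x n" "\<And>n. x n \<le> u"
  shows "x \<longlonglongrightarrow> 0"
proof -
  define s where "s n = u - (\<Sum>i<n. x i)" for n
  have "0 \<le> u" using x order_trans by blast
  then have "0 \<le> s n" for n
    using sum_disjoint_le[of "{..<n}" u x] disj x by (simp add: s_def)
  moreover have "decseq s"
    unfolding s_def using x(1) by (intro decseq_SucI) simp
  ultimately obtain l where "s \<longlonglongrightarrow> l"
    using order_continuous_decreasing_convergent[OF ocn] by metis
  then have "(\<lambda>n. s n - s (Suc n)) \<longlonglongrightarrow> l - l"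
    by (intro tendsto_diff LIMSEQ_Suc)
  then show ?thesis by (simp add: s_def)
qed

section \<open>Positive operators and functionals\<close>

lemma blinfun_nonneg:
  fixes T :: "'a::banach_lattice \<Rightarrow>\<^sub>L 'b::banach_lattice"
  shows "0 \<le> T \<Longrightarrow> 0 \<le> x \<Longrightarrow> 0 \<le> T x"
  unfolding less_eq_blinfun_def by simp

lemma blinfun_mono:
  fixes T :: "'a::banach_lattice \<Rightarrow>\<^sub>L 'b::banach_lattice"
  assumes "0 \<le> T" "x \<le> y"
  shows "T x \<le> T y"
  using blinfun_nonneg[OF assms(1), of "y - x"] assms(2) by (simp add: blinfun.diff_right)

lemma blinfun_abs_le:
  fixes T :: "'a::banach_lattice \<Rightarrow>\<^sub>L 'b::banach_lattice"
  assumes "0 \<le> T"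
  shows "\<bar>T x\<bar> \<le> T \<bar>x\<bar>"
proof (rule abs_leI)
  show "T x \<le> T \<bar>x\<bar>" by (intro blinfun_mono assms abs_ge_self)
  have "T (- x) \<le> T \<bar>x\<bar>" by (intro blinfun_mono assms abs_ge_minus_self)
  then show "- T x \<le> T \<bar>x\<bar>" by (simp add: blinfun.minus_right)
qed

text \<open>
  The functionals below arise as suprema or infima that are only computed on the positive cone;
  the decomposition \<open>x = x\<^sup>+ - (-x)\<^sup>+\<close> extends them to the whole space.
\<close>

lemma positive_functional_extension:
  fixes F :: "'a::banach_lattice \<Rightarrow> real"
  assumes add: "\<And>y z. 0 \<le> y \<Longrightarrow> 0 \<le> z \<Longrightarrow> F (y + z) = F y + F z"
    and scale: "\<And>c y. 0 < c \<Longrightarrow> 0 \<le> y \<Longrightarrow> F (c *\<^sub>R y) \<le> c * F y"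
    and bound: "\<And>y. 0 \<le> y \<Longrightarrow> 0 \<le> F y \<and> F y \<le> M * norm y"
  obtains g :: "'a \<Rightarrow>\<^sub>L real" where "0 \<le> g" "\<And>y. 0 \<le> y \<Longrightarrow> g y = F y"
proof -
  define G where "G x = F (pprt x) - F (pprt (- x))" for x
  have G: "G (a - b) = F a - F b" if "0 \<le> a" "0 \<le> b" for a b
  proof -
    have "a - b = pprt (a - b) - pprt (- (a - b))"
      using prts[of "a - b"] by (simp only: pprt_neg) simp
    then have "a + pprt (- (a - b)) = pprt (a - b) + b"
      by (simp only: algebra_simps)
    then have "F (a + pprt (- (a - b))) = F (pprt (a - b) + b)" by (rule arg_cong)
    then have "F a + F (pprt (- (a - b))) = F (pprt (a - b)) + F b"
      using that by (simp only: add zero_le_pprt)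
    then show ?thesis unfolding G_def by linarith
  qed
  have part: "x = pprt x - pprt (- x)" for x :: 'a
    using prts[of x] by (simp only: pprt_neg) simp
  have scale_eq: "F (c *\<^sub>R y) = c * F y" if "0 < c" "0 \<le> y" for c y
  proof (rule order_antisym[OF scale[OF that]])
    have "F (inverse c *\<^sub>R (c *\<^sub>R y)) \<le> inverse c * F (c *\<^sub>R y)"
      using that by (intro scale) (auto intro: scaleR_nonneg_nonneg)
    then show "c * F y \<le> F (c *\<^sub>R y)" using that by (simp add: field_simps)
  qed
  have Gpos: "G (c *\<^sub>R x) = c * G x" if "0 < c" for c x
  proof -
    have "c *\<^sub>R x = c *\<^sub>R pprt x - c *\<^sub>R pprt (- x)"
      by (subst part[of x]) (simp only: scaleR_diff_right)
    then have "G (c *\<^sub>R x) = F (c *\<^sub>R pprt x) - F (c *\<^sub>R pprt (- x))"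
      using that G[of "c *\<^sub>R pprt x" "c *\<^sub>R pprt (- x)"] by (simp only:) (simp add: scaleR_nonneg_nonneg)
    then show ?thesis using that by (simp add: scale_eq G_def right_diff_distrib)
  qed
  have Gneg: "G (- x) = - G x" for x by (simp add: G_def)
  have "bounded_linear G"
  proof (rule bounded_linear_intro)
    fix x y :: 'a
    have "x + y = (pprt x + pprt y) - (pprt (- x) + pprt (- y))"
      by (subst part[of x], subst part[of y]) (simp only: algebra_simps)
    then have "G (x + y) = F (pprt x + pprt y) - F (pprt (- x) + pprt (- y))"
      using G[of "pprt x + pprt y" "pprt (- x) + pprt (- y)"] by (simp only:) simp
    then show "G (x + y) = G x + G y" by (simp add: add G_def)
  next
    fix c and x :: 'a
    have "G 0 = 0" using G[of 0 0] by simp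
    then show "G (c *\<^sub>R x) = c *\<^sub>R G x"
      using Gpos[of c x] Gpos[of "- c" x] Gneg[of "c *\<^sub>R x"]
      by (cases "0::real" c rule: linorder_cases) auto
  next
    fix x :: 'a
    have M: "M * norm y \<le> \<bar>M\<bar> * norm x" if "norm y \<le> norm x" for y
      using that by (intro mult_mono) auto
    have "F (pprt x) \<le> \<bar>M\<bar> * norm x" "F (pprt (- x)) \<le> \<bar>M\<bar> * norm x"
      using bound[of "pprt x"] bound[of "pprt (- x)"] M[of "pprt x"] M[of "pprt (- x)"]
        norm_pprt_le[of x] norm_pprt_le[of "- x"] by auto
    then show "norm (G x) \<le> norm x * \<bar>M\<bar>"
      using bound[of "pprt x"] bound[of "pprt (- x)"] by (auto simp: G_def mult.commute abs_le_iff)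
  qed
  then have G_apply: "blinfun_apply (Blinfun G) = G" by (rule bounded_linear_Blinfun_apply)
  have GF: "G y = F y" if "0 \<le> y" for y
    using G[of y 0] add[of 0 0] that by simp
  show thesis
  proof
    show "0 \<le> Blinfun G"
      using bound by (auto simp: less_eq_blinfun_def G_apply GF)
    show "Blinfun G y = F y" if "0 \<le> y" for y using GF[OF that] by (simp add: G_apply)
  qed
qed

text \<open>The functional constructed here is the modulus of \<open>f\<close> in the dual Banach lattice.\<close>

lemma functional_dominated_by_positive:
  fixes f :: "'a::banach_lattice \<Rightarrow>\<^sub>L real"
  obtains g :: "'a \<Rightarrow>\<^sub>L real" where "0 \<le> g" "\<And>x. 0 \<le> x \<Longrightarrow> \<bar>f x\<bar> \<le> g x"
proof -
  define S where "S y = f ` {z. \<bar>z\<bar> \<le> y}" for y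
  have bnd: "t \<le> norm f * norm y" if "t \<in> S y" for t y
  proof -
    from that obtain z where z: "t = f z" "\<bar>z\<bar> \<le> y" by (auto simp: S_def)
    have "norm z \<le> norm y" using norm_mono_nonneg[of "\<bar>z\<bar>" y] z by simp
    then have "norm f * norm z \<le> norm f * norm y" by (intro mult_left_mono) auto
    then show ?thesis using norm_blinfun[of f z] z by auto
  qed
  have bdd: "bdd_above (S y)" for y using bnd by (intro bdd_aboveI) auto
  have zero: "0 \<in> S y" if "0 \<le> y" for y
    unfolding S_def using that by (intro image_eqI[of _ _ 0]) auto
  define F where "F y = Sup (S y)" for y
  have upper: "f z \<le> F y" if "\<bar>z\<bar> \<le> y" for z y
    unfolding F_def using that bdd by (intro cSup_upper) (auto simp: S_def)
  have least: "F y \<le> t" if "0 \<le> y" "\<And>z. \<bar>z\<bar> \<le> y \<Longrightarrow> f z \<le> t" for y t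
    unfolding F_def using that zero by (intro cSup_least) (auto simp: S_def)
  obtain g :: "'a \<Rightarrow>\<^sub>L real" where g: "0 \<le> g" "\<And>y. 0 \<le> y \<Longrightarrow> g y = F y"
  proof (rule positive_functional_extension[of F "norm f"])
    fix y z :: 'a assume y: "0 \<le> y" and z: "0 \<le> z"
    show "F (y + z) = F y + F z"
    proof (rule order_antisym)
      show "F (y + z) \<le> F y + F z"
      proof (rule least)
        fix x assume "\<bar>x\<bar> \<le> y + z"
        then obtain a b where "x = a + b" "\<bar>a\<bar> \<le> y" "\<bar>b\<bar> \<le> z"
          using riesz_decomposition[OF y z] by metis
        then show "f x \<le> F y + F z"
          using upper[of a y] upper[of b z] by (simp add: blinfun.add_right)
      qed (use y z in simp)
      have "F y \<le> F (y + z) - f b" if b: "\<bar>b\<bar> \<le> z" for b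
      proof (rule least[OF y])
        fix a assume "\<bar>a\<bar> \<le> y"
        then have "\<bar>a + b\<bar> \<le> y + z"
          using b by (meson abs_triangle_ineq add_mono order_trans)
        from upper[OF this] show "f a \<le> F (y + z) - f b" by (simp add: blinfun.add_right)
      qed
      then have "F z \<le> F (y + z) - F y"
        by (intro least[OF z]) (simp add: algebra_simps)
      then show "F y + F z \<le> F (y + z)" by simp
    qed
  next
    fix c :: real and y :: 'a assume c: "0 < c" and y: "0 \<le> y"
    show "F (c *\<^sub>R y) \<le> c * F y"
    proof (rule least)
      fix z assume "\<bar>z\<bar> \<le> c *\<^sub>R y"
      then have "inverse c *\<^sub>R \<bar>z\<bar> \<le> inverse c *\<^sub>R (c *\<^sub>R y)"
        using c by (intro scaleR_left_mono) auto
      then have "\<bar>inverse c *\<^sub>R z\<bar> \<le> y"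
        using c by (simp add: abs_scaleR_lattice)
      from upper[OF this] show "f z \<le> c * F y"
        using c by (simp add: blinfun.scaleR_right field_simps)
    qed (use c y in \<open>simp add: scaleR_nonneg_nonneg\<close>)
  next
    fix y :: 'a assume y: "0 \<le> y"
    have "F y \<le> norm f * norm y"
      using y bnd by (intro least) (auto simp: S_def)
    moreover have "0 \<le> F y" using upper[of 0 y] y by simp
    ultimately show "0 \<le> F y \<and> F y \<le> norm f * norm y" by simp
  qed (use that in auto)
  show thesis
  proof (rule that[OF g(1)])
    show "\<bar>f x\<bar> \<le> g x" if "0 \<le> x" for x
      using upper[of x x] upper[of "- x" x] that g(2)[of x] by (simp add: blinfun.minus_right abs_le_iff)
  qed
qed

text \<open>
  The functional \<open>g\<close> is the part of \<open>f\<close> that lives on the ideal generated by \<open>w\<close>. The truncations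
  \<open>inf y (k w)\<close> are subadditive in \<open>y\<close>, and superadditive if \<open>k\<close> is doubled for the sum; so the limit is
  additive.
\<close>

lemma functional_ideal_component:
  fixes f :: "'a::banach_lattice \<Rightarrow>\<^sub>L real"
  assumes f: "0 \<le> f" and w: "0 \<le> w"
  obtains g :: "'a \<Rightarrow>\<^sub>L real" where "0 \<le> g"
    "\<And>y. 0 \<le> y \<Longrightarrow> incseq (\<lambda>k. f (inf y (real k *\<^sub>R w)))"
    "\<And>y. 0 \<le> y \<Longrightarrow> (\<lambda>k. f (inf y (real k *\<^sub>R w))) \<longlonglongrightarrow> g y"
proof -
  define s where "s y k = f (inf y (real k *\<^sub>R w))" for y k
  define F where "F y = (SUP k. s y k)" for y
  have mono: "s y k \<le> s y l" if "k \<le> l" for y k l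
    unfolding s_def using that w
    by (intro blinfun_mono f inf_mono order_refl scaleR_right_mono) auto
  then have inc: "incseq (s y)" for y by (simp add: incseq_def)
  have le: "s y k \<le> f y" for y k unfolding s_def by (intro blinfun_mono f) simp
  then have bdd: "bdd_above (range (s y))" for y
    by (intro bdd_aboveI[of _ "f y"]) auto
  have lim: "s y \<longlonglongrightarrow> F y" for y
    unfolding F_def by (intro LIMSEQ_incseq_SUP bdd inc)
  have upper: "s y k \<le> F y" for y k unfolding F_def by (intro cSUP_upper bdd) auto
  obtain g :: "'a \<Rightarrow>\<^sub>L real" where g: "0 \<le> g" "\<And>y. 0 \<le> y \<Longrightarrow> g y = F y"
  proof (rule positive_functional_extension[of F "norm f"])
    fix y z :: 'a assume y: "0 \<le> y" and z: "0 \<le> z"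
    have kw: "0 \<le> real k *\<^sub>R w" for k using w by (simp add: scaleR_nonneg_nonneg)
    show "F (y + z) = F y + F z"
    proof (rule order_antisym)
      have "s (y + z) k \<le> F y + F z" for k
      proof -
        have "s (y + z) k \<le> f (inf y (real k *\<^sub>R w) + inf z (real k *\<^sub>R w))"
          unfolding s_def by (intro blinfun_mono f inf_add_le y z kw)
        also have "\<dots> \<le> F y + F z"
          using upper[of y k] upper[of z k] by (simp add: blinfun.add_right s_def)
        finally show ?thesis .
      qed
      then show "F (y + z) \<le> F y + F z" unfolding F_def by (intro cSUP_least) auto
      have "s y k + s z k \<le> F (y + z)" for k
      proof -
        have "s y k + s z k = f (inf y (real k *\<^sub>R w) + inf z (real k *\<^sub>R w))"
          by (simp add: blinfun.add_right s_def)
        also have "\<dots> \<le> s (y + z) (k + k)"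
          unfolding s_def of_nat_add scaleR_add_left
          by (intro blinfun_mono f le_infI add_mono inf_le1 inf_le2)
        finally show ?thesis using upper order_trans by blast
      qed
      then show "F y + F z \<le> F (y + z)"
        using tendsto_add[OF lim[of y] lim[of z]] by (intro LIMSEQ_le_const2) auto
    qed
  next
    fix c :: real and y :: 'a assume c: "0 < c" and y: "0 \<le> y"
    have "s (c *\<^sub>R y) k \<le> c * F y" for k
    proof -
      obtain l where l: "real k / c \<le> real l" using real_arch_simple by blast
      have "real k *\<^sub>R w \<le> c *\<^sub>R (real l *\<^sub>R w)"
        using scaleR_right_mono[of "real k" "c * real l" w] l c w by (simp add: field_simps)
      then have "inf (c *\<^sub>R y) (real k *\<^sub>R w) \<le> c *\<^sub>R inf y (real l *\<^sub>R w)"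
        unfolding scaleR_inf[OF c] by (intro inf_mono order_refl)
      then have "s (c *\<^sub>R y) k \<le> f (c *\<^sub>R inf y (real l *\<^sub>R w))"
        unfolding s_def by (intro blinfun_mono f)
      also have "\<dots> = c * s y l" by (simp add: blinfun.scaleR_right s_def)
      also have "\<dots> \<le> c * F y" using c upper by simp
      finally show ?thesis .
    qed
    then show "F (c *\<^sub>R y) \<le> c * F y" unfolding F_def by (intro cSUP_least) auto
  next
    fix y :: 'a assume y: "0 \<le> y"
    have "F y \<le> f y" unfolding F_def using le by (intro cSUP_least) auto
    moreover have "f y \<le> norm f * norm y" using norm_blinfun[of f y] by simp
    moreover have "0 \<le> s y 0" using y by (simp add: s_def inf_absorb2)
    ultimately show "0 \<le> F y \<and> F y \<le> norm f * norm y" using upper[of y 0] by simp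
  qed (use that in auto)
  show thesis
    using that[OF g(1)] inc lim g(2) unfolding s_def by simp
qed

text \<open>
  The elements \<open>inf y (k w\<^sub>n)\<close>, for distinct \<open>n\<close>, are disjoint and below \<open>y\<close>, hence so is their sum.
  Therefore the components of \<open>f\<close> belonging to the \<open>w\<^sub>n\<close> add up to at most \<open>f\<close>.
\<close>

lemma functional_disjoint_components:
  fixes f :: "'a::banach_lattice \<Rightarrow>\<^sub>L real"
  assumes f: "0 \<le> f" and w: "\<And>n. 0 \<le> w n"
    and disj: "\<And>m n. m \<noteq> n \<Longrightarrow> inf (w m) (w n) = 0"
  obtains g :: "nat \<Rightarrow> 'a \<Rightarrow>\<^sub>L real" where "\<And>n. 0 \<le> g n" "\<And>n. f (w n) \<le> g n (w n)"
    "\<And>N y. 0 \<le> y \<Longrightarrow> (\<Sum>n<N. g n y) \<le> f y"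
proof -
  have "\<exists>g :: 'a \<Rightarrow>\<^sub>L real. 0 \<le> g \<and> (\<forall>y\<ge>0. incseq (\<lambda>k. f (inf y (real k *\<^sub>R w n))) \<and>
    (\<lambda>k. f (inf y (real k *\<^sub>R w n))) \<longlonglongrightarrow> blinfun_apply g y)" for n
    using functional_ideal_component[OF f w[of n]] by metis
  then obtain g :: "nat \<Rightarrow> 'a \<Rightarrow>\<^sub>L real" where g: "\<And>n. 0 \<le> g n"
    "\<And>n y. 0 \<le> y \<Longrightarrow> incseq (\<lambda>k. f (inf y (real k *\<^sub>R w n)))"
    "\<And>n y. 0 \<le> y \<Longrightarrow> (\<lambda>k. f (inf y (real k *\<^sub>R w n))) \<longlonglongrightarrow> g n y"
    by metis
  show thesis
  proof
    show "0 \<le> g n" for n by fact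
    show "f (w n) \<le> g n (w n)" for n
      using incseq_le[OF g(2)[OF w[of n], of n] g(3)[OF w[of n], of n], of 1] by simp
    fix N and y :: 'a assume y: "0 \<le> y"
    have "(\<Sum>n<N. f (inf y (real k *\<^sub>R w n))) \<le> f y" for k
    proof (cases "k = 0")
      case True
      then show ?thesis using blinfun_nonneg[OF f y] y by (simp add: inf_absorb2)
    next
      case False
      have kw: "0 \<le> real k *\<^sub>R w n" for n using w by (simp add: scaleR_nonneg_nonneg)
      have "inf (real k *\<^sub>R w m) (real k *\<^sub>R w n) = 0" if "m \<noteq> n" for m n
        using scaleR_inf[of "real k" "w m" "w n"] False disj[OF that] by simp
      then have "inf (inf y (real k *\<^sub>R w m)) (inf y (real k *\<^sub>R w n)) = 0" if "m \<noteq> n" for m n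
        by (rule inf_eq_0_mono) (use that y kw in auto)
      then have "(\<Sum>n<N. inf y (real k *\<^sub>R w n)) \<le> y"
        using y kw by (intro sum_disjoint_le) auto
      then show ?thesis
        using blinfun_mono[OF f] by (fastforce simp: blinfun.sum_right)
    qed
    moreover have "(\<lambda>k. \<Sum>n<N. f (inf y (real k *\<^sub>R w n))) \<longlonglongrightarrow> (\<Sum>n<N. g n y)"
      by (intro tendsto_sum g(3) y)
    ultimately show "(\<Sum>n<N. g n y) \<le> f y"
      by (intro LIMSEQ_le_const2) auto
  qed
qed

text \<open>
  So \<open>y \<mapsto> (g\<^sub>n y)\<^sub>n\<close> is a positive operator into \<open>\<ell>\<^sup>1\<close> of norm at most \<open>\<parallel>f\<parallel>\<close>.
\<close>

lemma dominated_functionals_summable: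
  fixes f :: "'a::banach_lattice \<Rightarrow>\<^sub>L real" and g :: "nat \<Rightarrow> 'a \<Rightarrow>\<^sub>L real"
  assumes g: "\<And>n. 0 \<le> g n" and sum_le: "\<And>N y. 0 \<le> y \<Longrightarrow> (\<Sum>n<N. g n y) \<le> f y"
  shows "summable (\<lambda>n. \<bar>g n y\<bar>)" "(\<Sum>n. \<bar>g n y\<bar>) \<le> norm f * norm y"
proof -
  have le: "\<bar>g n y\<bar> \<le> g n \<bar>y\<bar>" for n by (intro blinfun_abs_le g)
  have "summable (\<lambda>n. g n \<bar>y\<bar>)"
    using sum_le[of "\<bar>y\<bar>"] blinfun_nonneg[OF g, of "\<bar>y\<bar>"]
    by (intro bounded_imp_summable[of _ "f \<bar>y\<bar>"])
      (auto simp flip: lessThan_Suc_atMost simp del: sum.lessThan_Suc)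
  then show sm: "summable (\<lambda>n. \<bar>g n y\<bar>)"
    using le by (intro summable_rabs_comparison_test) auto
  have "(\<Sum>n<N. \<bar>g n y\<bar>) \<le> f \<bar>y\<bar>" for N
  proof -
    have "(\<Sum>n<N. \<bar>g n y\<bar>) \<le> (\<Sum>n<N. g n \<bar>y\<bar>)" by (intro sum_mono le)
    also have "\<dots> \<le> f \<bar>y\<bar>" by (intro sum_le) simp
    finally show ?thesis .
  qed
  then have "(\<Sum>n. \<bar>g n y\<bar>) \<le> f \<bar>y\<bar>"
    using sm by (intro suminf_le_const) auto
  also have "\<dots> \<le> norm f * norm y" using norm_blinfun[of f "\<bar>y\<bar>"] by simp
  finally show "(\<Sum>n. \<bar>g n y\<bar>) \<le> norm f * norm y" .
qed

text \<open>
  The composition with the operator from \<open>\<ell>\<^sup>1\<close> that maps the unit vectors to \<open>x\<^sub>n\<close>. Scalar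
  \<open>x\<^sub>n\<close> give the signed sums of the \<open>g\<^sub>n\<close> as functionals.
\<close>

lemma dominated_functionals_series:
  fixes f :: "'a::banach_lattice \<Rightarrow>\<^sub>L real" and g :: "nat \<Rightarrow> 'a \<Rightarrow>\<^sub>L real"
    and x :: "nat \<Rightarrow> 'b::banach"
  assumes g: "\<And>n. 0 \<le> g n" and sum_le: "\<And>N y. 0 \<le> y \<Longrightarrow> (\<Sum>n<N. g n y) \<le> f y"
    and x: "\<And>n. norm (x n) \<le> 1"
  obtains T :: "'a \<Rightarrow>\<^sub>L 'b" where "\<And>y. (\<lambda>n. g n y *\<^sub>R x n) sums T y"
proof -
  note sm = dominated_functionals_summable[OF g sum_le]
  define t where "t y = (\<Sum>n. g n y *\<^sub>R x n)" for y
  have le: "norm (g n y *\<^sub>R x n) \<le> \<bar>g n y\<bar>" for n y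
    using mult_left_mono[OF x[of n], of "\<bar>g n y\<bar>"] by simp
  have sums: "(\<lambda>n. g n y *\<^sub>R x n) sums t y" for y
    unfolding t_def using le by (intro summable_sums summable_comparison_test[OF _ sm(1)]) auto
  have "bounded_linear t"
  proof (rule bounded_linear_intro)
    fix y z and c :: real
    show "t (y + z) = t y + t z"
      using sums_add[OF sums sums, of y z] sums[of "y + z"]
      by (simp add: blinfun.add_right scaleR_add_left sums_unique2)
    show "t (c *\<^sub>R y) = c *\<^sub>R t y"
      using sums_scaleR_right[OF sums[of y], of c] sums[of "c *\<^sub>R y"]
      by (simp add: blinfun.scaleR_right sums_unique2)
    have "norm (t y) \<le> (\<Sum>n. \<bar>g n y\<bar>)"
      unfolding t_def using le by (intro norm_suminf_le sm(1))
    then show "norm (t y) \<le> norm y * norm f" using sm(2)[of y] by (simp add: mult.commute)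
  qed
  then show thesis
    using that[of "Blinfun t"] sums by (simp add: bounded_linear_Blinfun_apply)
qed

section \<open>Disjoint sequences\<close>

lemma pprt_le_pprt_diff_add:
  fixes p q :: "'a::banach_lattice"
  assumes "0 \<le> q"
  shows "pprt p \<le> pprt (p - q) + q"
proof -
  have "p - q \<le> pprt (p - q)" by (simp add: pprt_def)
  then have "p \<le> pprt (p - q) + q" by (simp add: algebra_simps)
  moreover have "0 \<le> pprt (p - q) + q" using assms by simp
  ultimately show ?thesis unfolding pprt_def[of p] by simp
qed

text \<open>
  The unit ball is not approximately order bounded for the seminorm \<open>\<parallel>T \<bar>\<cdot>\<bar>\<parallel>\<close>. Hence there are
  \<open>x\<^sub>n\<close> whose part above \<open>4\<^sup>n\<close> times the sum of the preceding ones is large. Cutting off in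
  addition a small multiple of a fixed element \<open>z\<close> that dominates multiples of all \<open>x\<^sub>n\<close> makes
  the remainders disjoint.
\<close>

lemma disjoint_sequence_if_not_order_bounded:
  fixes T :: "'a::banach_lattice \<Rightarrow>\<^sub>L 'b::banach_lattice"
  assumes T: "0 \<le> T" and "0 < \<epsilon>"
    and large: "\<forall>u\<ge>0. \<exists>x\<ge>0. norm x \<le> 1 \<and> \<epsilon> < norm (T (pprt (x - u)))"
  shows "\<exists>w. (\<forall>n :: nat. 0 \<le> w n \<and> norm (w n) \<le> 1 \<and> \<epsilon> / 2 < norm (T (w n))) \<and>
    (\<forall>m n. m \<noteq> n \<longrightarrow> inf (w m) (w n) = 0)"
proof -
  obtain c where c: "\<And>u. 0 \<le> u \<Longrightarrow> 0 \<le> c u \<and> norm (c u) \<le> 1 \<and> \<epsilon> < norm (T (pprt (c u - u)))"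
    using large by metis
  define S where "S = rec_nat 0 (\<lambda>n s. s + c (4 ^ n *\<^sub>R s))"
  define x where "x n = c (4 ^ n *\<^sub>R S n)" for n
  have S_Suc: "S (Suc n) = S n + x n" and S_0: "S 0 = 0" for n
    by (simp_all add: S_def x_def)
  have S_pos: "0 \<le> S n" for n
    by (induction n) (use c in \<open>auto simp: S_Suc S_0 x_def scaleR_nonneg_nonneg\<close>)
  have x: "0 \<le> x n" "norm (x n) \<le> 1" "\<epsilon> < norm (T (pprt (x n - 4 ^ n *\<^sub>R S n)))" for n
    using c[of "4 ^ n *\<^sub>R S n"] S_pos[of n] by (simp_all add: x_def scaleR_nonneg_nonneg)
  have S: "S n = (\<Sum>i<n. x i)" for n by (induction n) (simp_all add: S_Suc S_0)
  define z where "z = (\<Sum>n. (1/2) ^ n *\<^sub>R x n)"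
  have sm: "summable (\<lambda>n. (1/2) ^ n *\<^sub>R x n)"
  proof (rule summable_comparison_test)
    show "\<exists>N. \<forall>n\<ge>N. norm ((1/2) ^ n *\<^sub>R x n) \<le> (1/2) ^ n"
      using x(2) by (auto simp: power_divide divide_le_cancel)
  qed simp
  have pos: "0 \<le> (1/2) ^ n *\<^sub>R x n" for n using x(1) by (simp add: scaleR_nonneg_nonneg)
  have z: "(1/2) ^ n *\<^sub>R x n \<le> z" for n
    unfolding z_def by (rule lattice_member_le_suminf[OF sm pos])
  have "0 \<le> z" using pos z order_trans by blast
  then have z_pos: "0 \<le> (1/2) ^ n *\<^sub>R z" for n by (intro scaleR_nonneg_nonneg) auto
  define w where "w n = pprt (x n - 4 ^ n *\<^sub>R S n - (1/2) ^ n *\<^sub>R z)" for n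
  have SS: "0 \<le> (4::real) ^ n *\<^sub>R S n" for n using S_pos by (simp add: scaleR_nonneg_nonneg)
  have disj: "inf (w n) (w m) = 0" if "m < n" for m n
  proof (rule disjoint_if_le_pprt_diff)
    show "1 \<le> (4::real) ^ n" by simp
    show "0 \<le> w n" "0 \<le> w m" by (simp_all add: w_def)
    have "x m \<le> S n" unfolding S using that x(1) sum_mono2[of "{..<n}" "{m}" x] by auto
    then have "4 ^ n *\<^sub>R x m \<le> (4::real) ^ n *\<^sub>R S n" by (intro scaleR_left_mono) auto
    then have "x n - 4 ^ n *\<^sub>R S n - (1/2) ^ n *\<^sub>R z \<le> x n - 4 ^ n *\<^sub>R x m - 0"
      using z_pos[of n] by (intro diff_mono) auto
    then show "w n \<le> pprt (x n - 4 ^ n *\<^sub>R x m)" unfolding w_def by (intro pprt_mono) simp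
    (* The multiple of z subtracted in w m exceeds the multiple of x n that disjointness asks for. *)
    have "inverse ((4::real) ^ n) \<le> (1/2) ^ m * (1/2) ^ n"
    proof -
      have "inverse ((4::real) ^ n) = (1/2) ^ n * (1/2) ^ n"
        by (simp add: power_mult_distrib[symmetric] inverse_eq_divide power_one_over)
      also have "\<dots> \<le> (1/2) ^ m * (1/2) ^ n"
        using that by (intro mult_right_mono power_decreasing) auto
      finally show ?thesis .
    qed
    then have "inverse (4 ^ n) *\<^sub>R x n \<le> ((1/2) ^ m * (1/2) ^ n) *\<^sub>R x n"
      using x(1) by (intro scaleR_right_mono) auto
    also have "\<dots> \<le> (1/2) ^ m *\<^sub>R z"
      using scaleR_left_mono[OF z[of n], of "(1/2) ^ m"] by simp
    finally have "x m - 4 ^ m *\<^sub>R S m - (1/2) ^ m *\<^sub>R z \<le> x m - 0 - inverse (4 ^ n) *\<^sub>R x n"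
      using SS[of m] by (intro diff_mono) auto
    then show "w m \<le> pprt (x m - inverse (4 ^ n) *\<^sub>R x n)"
      unfolding w_def by (intro pprt_mono) simp
  qed
  have w_le: "w n \<le> x n" for n
    unfolding w_def pprt_def using z_pos[of n] SS[of n] x(1)[of n]
    by (auto simp: diff_le_eq add_increasing add_increasing2)
  have w_large: "\<epsilon> - (1/2) ^ n * norm (T z) < norm (T (w n))" for n
  proof -
    have "T (pprt (x n - 4 ^ n *\<^sub>R S n)) \<le> T (w n + (1/2) ^ n *\<^sub>R z)"
      unfolding w_def by (intro blinfun_mono T pprt_le_pprt_diff_add z_pos)
    then have "norm (T (pprt (x n - 4 ^ n *\<^sub>R S n))) \<le> norm (T (w n + (1/2) ^ n *\<^sub>R z))"
      by (intro norm_mono_nonneg blinfun_nonneg T zero_le_pprt)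
    also have "\<dots> \<le> norm (T (w n)) + (1/2) ^ n * norm (T z)"
      using norm_triangle_ineq[of "T (w n)" "(1/2) ^ n *\<^sub>R T z"]
      by (simp add: blinfun.add_right blinfun.scaleR_right)
    finally show ?thesis using x(3)[of n] by simp
  qed
  have "(\<lambda>n. (1/2) ^ n * norm (T z)) \<longlonglongrightarrow> 0"
    by (intro tendsto_mult_left_zero LIMSEQ_realpow_zero) auto
  then have "\<forall>\<^sub>F n in sequentially. (1/2) ^ n * norm (T z) < \<epsilon> / 2"
    using \<open>0 < \<epsilon>\<close> by (intro order_tendstoD) auto
  then obtain N where N: "\<And>n. N \<le> n \<Longrightarrow> (1/2) ^ n * norm (T z) < \<epsilon> / 2"
    by (auto simp: eventually_sequentially)
  have "0 \<le> w (n + N)" for n by (simp add: w_def)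
  moreover have "norm (w (n + N)) \<le> 1" for n
    using norm_mono_nonneg[OF _ w_le[of "n + N"]] x(2)[of "n + N"] by (fastforce simp: w_def)
  moreover have "\<epsilon> / 2 < norm (T (w (n + N)))" for n
    using N[of "n + N"] w_large[of "n + N"] by linarith
  moreover have "inf (w (m + N)) (w (n + N)) = 0" if "m \<noteq> n" for m n
    using that disj[of "m + N" "n + N"] disj[of "n + N" "m + N"]
    by (cases "m < n") (auto simp: inf_commute)
  ultimately show ?thesis by (intro exI[of _ "\<lambda>n. w (n + N)"] conjI allI impI) simp_all
qed

section \<open>The Hahn--Banach theorem\<close>

definition sublinear :: "('a::real_vector \<Rightarrow> real) \<Rightarrow> bool"
  where "sublinear q \<longleftrightarrow> (\<forall>x y. q (x + y) \<le> q x + q y) \<and> (\<forall>t>0. \<forall>x. q (t *\<^sub>R x) = t * q x)"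

lemma sublinear_0: "sublinear q \<Longrightarrow> q 0 = 0"
  unfolding sublinear_def by (metis scaleR_zero_right mult_cancel_right1 zero_less_numeral num.distinct(1) numeral_eq_one_iff)

lemma sublinear_minus_le:
  assumes "sublinear q"
  shows "- q (- x) \<le> q x"
proof -
  have "q (x + - x) \<le> q x + q (- x)" using assms unfolding sublinear_def by blast
  then show ?thesis using sublinear_0[OF assms] by simp
qed

text \<open>
  The functional \<open>r x = (INF t\<ge>0. q (x + t y) - t q y)\<close> is the largest sublinear one below \<open>q\<close> whose
  value at \<open>-y\<close> is at most \<open>- q y\<close>. A minimal sublinear functional is therefore odd, hence linear.
\<close>

lemma sublinear_tilt:
  fixes q :: "'a::real_vector \<Rightarrow> real"
  assumes q: "sublinear q"
  obtains r where "sublinear r" "r \<le> q" "r (- y) \<le> - q y"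
proof -
  have add: "q (x + z) \<le> q x + q z" and scale: "0 < t \<Longrightarrow> q (t *\<^sub>R x) = t * q x" for x z t
    using q unfolding sublinear_def by blast+
  define h where "h x t = q (x + t *\<^sub>R y) - t * q y" for x t
  define r where "r x = (INF t\<in>{0..}. h x t)" for x
  have h: "- q (- x) \<le> h x t" if "0 \<le> t" for x t
  proof -
    have "t * q y = q (t *\<^sub>R y)"
      using that scale[of t y] sublinear_0[OF q] by (cases "t = 0") auto
    moreover have "q (t *\<^sub>R y) \<le> q (x + t *\<^sub>R y) + q (- x)"
      using add[of "x + t *\<^sub>R y" "- x"] by simp
    ultimately show ?thesis unfolding h_def by linarith
  qed
  have lower: "r x \<le> h x t" if "0 \<le> t" for x t
    unfolding r_def using that h by (intro cINF_lower bdd_belowI2[of _ "- q (- x)"]) auto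
  have greatest: "c \<le> r x" if "\<And>t. 0 \<le> t \<Longrightarrow> c \<le> h x t" for c x
    unfolding r_def using that by (intro cINF_greatest) auto
  have r_add: "r (x + z) \<le> r x + r z" for x z
  proof -
    have "r (x + z) - h x s \<le> h z t" if "0 \<le> s" "0 \<le> t" for s t
    proof -
      have "r (x + z) \<le> h (x + z) (s + t)" using that by (intro lower) auto
      also have "\<dots> \<le> h x s + h z t"
        using add[of "x + s *\<^sub>R y" "z + t *\<^sub>R y"] unfolding h_def by (simp add: algebra_simps)
      finally show ?thesis by simp
    qed
    then have "r (x + z) - h x s \<le> r z" if "0 \<le> s" for s using that by (intro greatest) auto
    then have "r (x + z) - r z \<le> r x" by (intro greatest) (auto simp: algebra_simps)
    then show ?thesis by simp
  qed
  have r_scale_le: "r (s *\<^sub>R x) \<le> s * r x" if s: "0 < s" for s x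
  proof -
    have "r (s *\<^sub>R x) / s \<le> h x t" if "0 \<le> t" for t
    proof -
      have "r (s *\<^sub>R x) \<le> h (s *\<^sub>R x) (s * t)" using s that by (intro lower) auto
      also have "\<dots> = s * h x t"
        using scale[OF s, of "x + t *\<^sub>R y"] unfolding h_def by (simp add: algebra_simps)
      finally show ?thesis using s by (simp add: field_simps)
    qed
    then have "r (s *\<^sub>R x) / s \<le> r x" by (rule greatest)
    then show ?thesis using s by (simp add: field_simps)
  qed
  have r_scale: "r (s *\<^sub>R x) = s * r x" if s: "0 < s" for s x
    using r_scale_le[OF s, of x] r_scale_le[of "inverse s" "s *\<^sub>R x"] s by (simp add: field_simps)
  show thesis
  proof
    show "sublinear r" unfolding sublinear_def using r_add r_scale by blast
    show "r \<le> q" using lower[of 0] by (auto simp: le_fun_def h_def)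
    show "r (- y) \<le> - q y" using lower[of 1 "- y"] sublinear_0[OF q] by (simp add: h_def)
  qed
qed

lemma sublinear_chain_Inf:
  fixes p :: "'a::real_vector \<Rightarrow> real"
  assumes C: "C \<noteq> {}" "\<And>q. q \<in> C \<Longrightarrow> sublinear q \<and> q \<le> p"
    and chain: "\<And>q r. q \<in> C \<Longrightarrow> r \<in> C \<Longrightarrow> q \<le> r \<or> r \<le> q"
  obtains m where "sublinear m" "\<And>q. q \<in> C \<Longrightarrow> m \<le> q"
proof -
  define m where "m x = (INF q\<in>C. q x)" for x
  have "- p (- x) \<le> q x" if "q \<in> C" for q x
    using sublinear_minus_le[of q x] C(2)[OF that] by (auto simp: le_fun_def dest: spec[of _ "- x"])
  then have lower: "m x \<le> q x" if "q \<in> C" for q x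
    unfolding m_def using that by (intro cINF_lower bdd_belowI2[of _ "- p (- x)"]) auto
  have greatest: "c \<le> m x" if "\<And>q. q \<in> C \<Longrightarrow> c \<le> q x" for c x
    unfolding m_def using that C(1) by (intro cINF_greatest) auto
  have m_add: "m (x + y) \<le> m x + m y" for x y
  proof -
    have "m (x + y) - q x \<le> r y" if qr: "q \<in> C" "r \<in> C" for q r
    proof -
      obtain s where s: "s \<in> C" "s \<le> q" "s \<le> r" using chain[OF qr] qr by blast
      have "m (x + y) \<le> s (x + y)" by (rule lower[OF s(1)])
      also have "\<dots> \<le> s x + s y" using C(2)[OF s(1)] by (auto simp: sublinear_def)
      also have "\<dots> \<le> q x + r y" using s(2,3) by (auto simp: le_fun_def intro: add_mono)
      finally show ?thesis by simp
    qed
    then have "m (x + y) - q x \<le> m y" if "q \<in> C" for q using that by (intro greatest) auto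
    then have "m (x + y) - m y \<le> m x" by (intro greatest) (auto simp: algebra_simps)
    then show ?thesis by simp
  qed
  have m_scale_le: "m (t *\<^sub>R x) \<le> t * m x" if t: "0 < t" for t x
  proof -
    have "m (t *\<^sub>R x) / t \<le> q x" if "q \<in> C" for q
      using lower[OF that, of "t *\<^sub>R x"] C(2)[OF that] t by (simp add: sublinear_def field_simps)
    then have "m (t *\<^sub>R x) / t \<le> m x" by (rule greatest)
    then show ?thesis using t by (simp add: field_simps)
  qed
  have "m (t *\<^sub>R x) = t * m x" if t: "0 < t" for t x
    using m_scale_le[OF t, of x] m_scale_le[of "inverse t" "t *\<^sub>R x"] t by (simp add: field_simps)
  then have "sublinear m" using m_add by (auto simp: sublinear_def)
  then show thesis using that lower by (simp add: le_fun_def)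
qed

text \<open>
  Zorn's lemma provides a minimal sublinear functional. The search starts below a tilted \<open>p\<close>,
  which forces the value \<open>p y\<close> at \<open>y\<close>.
\<close>

theorem hahn_banach:
  fixes p :: "'a::real_vector \<Rightarrow> real"
  assumes p: "sublinear p"
  obtains f where "linear f" "\<And>x. f x \<le> p x" "f y = p y"
proof -
  obtain p' where p': "sublinear p'" "p' \<le> p" "p' (- y) \<le> - p y"
    using sublinear_tilt[OF p] by metis
  define A where "A = {q. sublinear q \<and> q \<le> p'}"
  have "\<exists>m\<in>A. \<forall>a\<in>A. a \<le> m \<longrightarrow> a = m"
  proof (rule predicate_Zorn)
    show "partial_order_on A (relation_of (\<lambda>a b. b \<le> a) A)"
      by (auto simp: partial_order_on_def preorder_on_def refl_on_def trans_def antisym_def relation_of_def)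
    fix C assume "C \<in> Chains (relation_of (\<lambda>a b. b \<le> a) A)"
    then have C: "C \<subseteq> A" "\<And>q r. q \<in> C \<Longrightarrow> r \<in> C \<Longrightarrow> q \<le> r \<or> r \<le> q"
      by (auto simp: Chains_def relation_of_def)
    show "\<exists>u\<in>A. \<forall>a\<in>C. u \<le> a"
    proof (cases "C = {}")
      case True
      then show ?thesis using p'(1) by (auto simp: A_def)
    next
      case False
      obtain m where m: "sublinear m" "\<And>q. q \<in> C \<Longrightarrow> m \<le> q"
        using sublinear_chain_Inf[of C p', OF False] C by (auto simp: A_def)
      obtain q where "q \<in> C" using False by blast
      then have "m \<le> p'" using m(2) C(1) by (force simp: A_def intro: order_trans)
      then show ?thesis using m by (auto simp: A_def)
    qed
  qed
  then obtain f where f: "sublinear f" "f \<le> p'" "\<And>a. sublinear a \<Longrightarrow> a \<le> f \<Longrightarrow> a = f"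
    unfolding A_def using order_trans by blast
  have odd: "f (- x) = - f x" for x
  proof -
    obtain r where "sublinear r" "r \<le> f" "r (- x) \<le> - f x"
      using sublinear_tilt[OF f(1)] by metis
    then have "f (- x) \<le> - f x" using f(3) by metis
    then show ?thesis using sublinear_minus_le[OF f(1), of x] by simp
  qed
  have add: "f (x + z) \<le> f x + f z" for x z using f(1) by (auto simp: sublinear_def)
  have "linear f"
  proof (rule linearI)
    show "f (x + z) = f x + f z" for x z
      using add[of x z] add[of "- x" "- z"] odd[of "x + z"] odd[of x] odd[of z] by simp
    show "f (t *\<^sub>R x) = t *\<^sub>R f x" for t x
      using f(1) sublinear_0[OF f(1)] odd[of "t *\<^sub>R x"] unfolding sublinear_def
      by (cases "0::real" t rule: linorder_cases) (auto dest: spec[of _ "- t"])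
  qed
  moreover have "f x \<le> p x" for x using f(2) p'(2) by (meson le_fun_def order_trans)
  moreover have "f y = p y"
    using odd[of y] f(2) p'(3) calculation(2)[of y] by (auto simp: le_fun_def dest: spec[of _ "- y"])
  ultimately show thesis using that by blast
qed

lemma norming_functional:
  fixes y :: "'a::real_normed_vector"
  obtains f :: "'a \<Rightarrow>\<^sub>L real" where "f y = norm y"
proof -
  have "sublinear (norm :: 'a \<Rightarrow> real)"
    by (auto simp: sublinear_def norm_triangle_ineq)
  then obtain f where f: "linear f" "\<And>x. f x \<le> norm x" "f y = norm y"
    using hahn_banach by metis
  have "\<bar>f x\<bar> \<le> norm x" for x
    using f(2)[of x] f(2)[of "- x"] linear_neg[OF f(1), of x] by (auto simp: abs_le_iff)
  then have "bounded_linear f"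
    using f(1) by (intro bounded_linear_intro[of _ 1]) (auto simp: linear_add linear_scale)
  then show thesis using that[of "Blinfun f"] f(3) by (simp add: bounded_linear_Blinfun_apply)
qed

text \<open>
  A linear functional dominated by \<open>x \<mapsto> \<parallel>x\<^sup>+\<parallel>\<close> is positive, because this sublinear functional
  vanishes on the negative cone.
\<close>

lemma positive_norming_functional:
  fixes y :: "'a::banach_lattice"
  assumes "0 \<le> y"
  obtains f :: "'a \<Rightarrow>\<^sub>L real" where "0 \<le> f" "f y = norm y" "\<And>x. f x \<le> norm x"
proof -
  have "sublinear (\<lambda>x :: 'a. norm (pprt x))"
    unfolding sublinear_def
  proof (intro conjI allI impI)
    fix x z :: 'a and t :: real
    have "pprt (x + z) \<le> pprt x + pprt z"
      unfolding pprt_def[of "x + z"]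
      by (intro le_supI add_mono add_nonneg_nonneg zero_le_pprt) (simp_all add: pprt_def)
    then have "norm (pprt (x + z)) \<le> norm (pprt x + pprt z)"
      by (intro norm_mono_nonneg zero_le_pprt)
    then show "norm (pprt (x + z)) \<le> norm (pprt x) + norm (pprt z)"
      using norm_triangle_ineq order_trans by blast
    show "norm (pprt (t *\<^sub>R x)) = t * norm (pprt x)" if "0 < t"
      using that scaleR_pprt[OF that, of x] norm_scaleR[of t "pprt x"] by simp
  qed
  then obtain f where f: "linear f" "\<And>x. f x \<le> norm (pprt x)" "f y = norm (pprt y)"
    using hahn_banach by metis
  have le: "f x \<le> norm x" for x using f(2)[of x] norm_pprt_le[of x] by simp
  have "\<bar>f x\<bar> \<le> norm x" for x
    using le[of x] le[of "- x"] linear_neg[OF f(1), of x] by (auto simp: abs_le_iff)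
  then have "bounded_linear f"
    using f(1) by (intro bounded_linear_intro[of _ 1]) (auto simp: linear_add linear_scale)
  then have ap: "blinfun_apply (Blinfun f) = f" by (rule bounded_linear_Blinfun_apply)
  have "0 \<le> f x" if "0 \<le> x" for x
    using f(2)[of "- x"] linear_neg[OF f(1), of x] that by simp
  then show thesis
    using that[of "Blinfun f"] f(3) le assms by (simp add: ap less_eq_blinfun_def)
qed

section \<open>The weak topology\<close>

lemma openin_weak_vimage:
  fixes f :: "'a::real_normed_vector \<Rightarrow>\<^sub>L real"
  assumes "open U"
  shows "openin weak_topology (blinfun_apply f -` U)"
  unfolding weak_topology_def using assms by (intro topology_generated_by_Basis) blast

lemma topspace_weak_topology [simp]:
  "topspace (weak_topology :: 'a::real_normed_vector topology) = UNIV"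
proof -
  have "openin weak_topology (blinfun_apply (0 :: 'a \<Rightarrow>\<^sub>L real) -` UNIV)"
    by (intro openin_weak_vimage) simp
  then show ?thesis using openin_subset by fastforce
qed

lemma Hausdorff_weak_topology: "Hausdorff_space (weak_topology :: 'a::real_normed_vector topology)"
  unfolding Hausdorff_space_def
proof (intro allI impI)
  fix x y :: 'a assume "x \<in> topspace weak_topology \<and> y \<in> topspace weak_topology \<and> x \<noteq> y"
  then have "x - y \<noteq> 0" by simp
  moreover obtain f :: "'a \<Rightarrow>\<^sub>L real" where "f (x - y) = norm (x - y)"
    using norming_functional by metis
  ultimately have "f x \<noteq> f y" by (auto simp: blinfun.diff_right)
  then obtain U V where "open U" "open V" "f x \<in> U" "f y \<in> V" "U \<inter> V = {}"
    using hausdorff by metis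
  then show "\<exists>U V. openin weak_topology U \<and> openin weak_topology V \<and> x \<in> U \<and> y \<in> V \<and> disjnt U V"
    using openin_weak_vimage[of U f] openin_weak_vimage[of V f]
    by (intro exI[of _ "blinfun_apply f -` U"] exI[of _ "blinfun_apply f -` V"])
      (auto simp: disjnt_def)
qed

lemma limitin_weak_topology:
  fixes x :: "nat \<Rightarrow> 'a::real_normed_vector"
  assumes "\<And>f :: 'a \<Rightarrow>\<^sub>L real. (\<lambda>n. f (x n)) \<longlonglongrightarrow> f l"
  shows "limitin weak_topology x l sequentially"
  unfolding limitin_def
proof (intro conjI allI impI)
  show "l \<in> topspace weak_topology" by simp
  fix U assume U: "openin weak_topology U \<and> l \<in> U"
  then have "generate_topology_on {blinfun_apply f -` U | (f :: 'a \<Rightarrow>\<^sub>L real) U. open U} U"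
    by (simp add: weak_topology_def openin_topology_generated_by_iff)
  moreover have "l \<in> U" using U by simp
  ultimately show "\<forall>\<^sub>F n in sequentially. x n \<in> U"
  proof (induction rule: generate_topology_on.induct)
    case (UN K)
    then obtain k where "k \<in> K" "\<forall>\<^sub>F n in sequentially. x n \<in> k" by blast
    then show ?case by (auto elim: eventually_mono)
  next
    case (Basis s)
    then obtain f :: "'a \<Rightarrow>\<^sub>L real" and V where "s = blinfun_apply f -` V" "open V" by blast
    then show ?case using topological_tendstoD[OF assms[of f]] Basis by simp
  qed (auto intro: eventually_conj)
qed

lemma relatively_weakly_compact_range:
  fixes x :: "nat \<Rightarrow> 'a::real_normed_vector"
  assumes "\<And>f :: 'a \<Rightarrow>\<^sub>L real. (\<lambda>n. f (x n)) \<longlonglongrightarrow> f l"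
  shows "relatively_weakly_compact (range x)"
proof -
  have K: "compactin weak_topology (insert l (range x))"
    by (intro compactin_sequence_with_limit[OF limitin_weak_topology[OF assms]]) auto
  then have "closedin weak_topology (insert l (range x))"
    by (rule compactin_imp_closedin[OF Hausdorff_weak_topology])
  then have "weak_topology closure_of range x \<subseteq> insert l (range x)"
    by (intro closure_of_minimal) auto
  then show ?thesis
    unfolding relatively_weakly_compact_def by (intro closed_compactin[OF K]) auto
qed

text \<open>
  The weak closures of the tails of the sequence have the finite intersection property. In the
  gliding hump argument below, cluster points take the place of the convergent subsequence that
  the theorem of Eberlein and Smulian would provide.
\<close>

lemma weak_cluster_point:
  fixes a :: "nat \<Rightarrow> 'a::real_normed_vector"
  assumes A: "relatively_weakly_compact A" and a: "\<And>n. a n \<in> A"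
  obtains l where "\<And>F e m. finite F \<Longrightarrow> 0 < e \<Longrightarrow>
    \<exists>k\<ge>m. \<forall>f\<in>F. \<bar>blinfun_apply f (a k) - blinfun_apply f l\<bar> < (e :: real)"
proof -
  let ?W = "weak_topology :: 'a topology"
  define C where "C m = ?W closure_of (a ` {m..})" for m
  have "?W closure_of A \<inter> (\<Inter>m. C m) \<noteq> {}"
  proof -
    have fip: "?W closure_of A \<inter> \<Inter>\<F> \<noteq> {}" if F: "finite \<F>" "\<F> \<subseteq> range C" for \<F>
    proof -
      obtain M where M: "finite M" "\<F> = C ` M" using finite_subset_image[OF F] by blast
      have "a (Sup M) \<in> C m" if "m \<in> M" for m
        using that M(1) closure_of_subset[of "a ` {m..}" ?W]
        by (auto simp: C_def intro: le_cSup_finite)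
      moreover have "a (Sup M) \<in> ?W closure_of A"
        using a closure_of_subset[of A ?W] by auto
      ultimately show ?thesis using M(2) by blast
    qed
    have "compactin ?W (?W closure_of A)" using A by (simp add: relatively_weakly_compact_def)
    then show ?thesis
      unfolding compactin_fip using fip by (auto simp: C_def dest!: spec[of _ "range C"])
  qed
  then obtain l where l: "\<And>m. l \<in> C m" by blast
  show thesis
  proof
    fix F :: "('a \<Rightarrow>\<^sub>L real) set" and e :: real and m :: nat
    assume F: "finite F" and e: "0 < e"
    define U where "U = (\<Inter>f\<in>F. blinfun_apply f -` ball (f l) e)"
    have "openin ?W (\<Inter>f\<in>F. blinfun_apply f -` ball (f l) e)" if "F \<noteq> {}"
      using F that by (intro openin_INT2 openin_weak_vimage) auto
    then have "openin ?W U" unfolding U_def by (cases "F = {}") (use openin_topspace[of ?W] in auto)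
    moreover have "l \<in> U" using e by (simp add: U_def)
    ultimately have "\<exists>y\<in>a ` {m..}. y \<in> U" using l[of m] unfolding C_def in_closure_of by blast
    then show "\<exists>k\<ge>m. \<forall>f\<in>F. \<bar>f (a k) - f l\<bar> < e"
      by (auto simp: U_def dist_real_def abs_minus_commute)
  qed
qed

lemma relatively_weakly_compact_bounded_functional:
  fixes f :: "'a::real_normed_vector \<Rightarrow>\<^sub>L real"
  assumes "relatively_weakly_compact A"
  obtains M where "0 \<le> M" "\<And>a. a \<in> A \<Longrightarrow> \<bar>f a\<bar> \<le> M"
proof -
  have "\<exists>M. \<forall>a\<in>A. \<bar>f a\<bar> \<le> M"
  proof (rule ccontr)
    assume "\<nexists>M. \<forall>a\<in>A. \<bar>f a\<bar> \<le> M"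
    then have "\<forall>n::nat. \<exists>a. a \<in> A \<and> real n < \<bar>f a\<bar>" by (meson not_le)
    then obtain a where a: "\<And>n::nat. a n \<in> A" "\<And>n. real n < \<bar>f (a n)\<bar>" by metis
    obtain l where l: "\<And>F e m. finite F \<Longrightarrow> 0 < e \<Longrightarrow>
      \<exists>k\<ge>m. \<forall>f\<in>F. \<bar>blinfun_apply f (a k) - blinfun_apply f l\<bar> < (e :: real)"
      using weak_cluster_point[OF assms, of a] a(1) by blast
    obtain m :: nat where m: "\<bar>f l\<bar> + 1 \<le> real m" using real_arch_simple by blast
    obtain k where k: "m \<le> k" "\<bar>f (a k) - f l\<bar> < 1" using l[of "{f}" 1 m] by auto
    then have "real m \<le> real k" by simp
    with k(2) m a(2)[of k] show False by linarith
  qed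
  then obtain M where "\<forall>a\<in>A. \<bar>f a\<bar> \<le> M" by blast
  then show thesis using that[of "max 0 M"] by (auto simp: le_max_iff_disj)
qed

section \<open>Order continuity of the dual norm\<close>

text \<open>
  The tails of the series of the components \<open>g\<^sub>n\<close> of \<open>f\<close> decrease to \<open>0\<close>, so their norms tend to \<open>0\<close>,
  and the \<open>n\<close>-th tail dominates \<open>g\<^sub>n\<close>, whose value at \<open>w\<^sub>n\<close> is at least \<open>f(w\<^sub>n)\<close>.
\<close>

lemma dual_order_continuous_disjoint_weakly_null:
  fixes w :: "nat \<Rightarrow> 'a::banach_lattice" and f :: "'a \<Rightarrow>\<^sub>L real"
  assumes ocn: "order_continuous_norm TYPE('a \<Rightarrow>\<^sub>L real)"
    and w: "\<And>n. 0 \<le> w n" "\<And>n. norm (w n) \<le> 1"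
    and disj: "\<And>m n. m \<noteq> n \<Longrightarrow> inf (w m) (w n) = 0"
  shows "(\<lambda>n. f (w n)) \<longlonglongrightarrow> 0"
proof -
  have pos: "(\<lambda>n. f (w n)) \<longlonglongrightarrow> 0" if f: "0 \<le> f" for f :: "'a \<Rightarrow>\<^sub>L real"
  proof -
    obtain g :: "nat \<Rightarrow> 'a \<Rightarrow>\<^sub>L real" where g: "\<And>n. 0 \<le> g n" "\<And>n. f (w n) \<le> g n (w n)"
      "\<And>N y. 0 \<le> y \<Longrightarrow> (\<Sum>n<N. g n y) \<le> f y"
      by (rule functional_disjoint_components[of f w, OF f w(1) disj]) (assumption, rule that)
    obtain s :: "'a \<Rightarrow>\<^sub>L real" where s: "\<And>y. (\<lambda>n. g n y *\<^sub>R (1::real)) sums s y"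
      using dominated_functionals_series[of g f "\<lambda>_. 1 :: real", OF g(1,3)] by auto
    then have s: "(\<lambda>n. g n y) sums s y" for y by simp
    define h where "h N = s - (\<Sum>n<N. g n)" for N
    have h: "h N y = s y - (\<Sum>n<N. g n y)" for N y
      by (simp add: h_def blinfun.diff_left blinfun.sum_left)
    have g_pos: "0 \<le> g n y" if "0 \<le> y" for n y using blinfun_nonneg[OF g(1) that] .
    have h_mono: "h n y \<le> h N y" if "N \<le> n" "0 \<le> y" for N n y
      unfolding h using that g_pos by (intro diff_left_mono sum_mono2) auto
    have h_pos: "0 \<le> h N y" if "0 \<le> y" for N y
      unfolding h using sum_le_suminf[OF sums_summable[OF s[of y]], of "{..<N}"] g_pos[OF that]
      by (simp add: sums_unique[OF s[of y]])
    have "z \<le> 0" if z: "\<forall>N. z \<le> h N" for z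
      unfolding less_eq_blinfun_def
    proof (intro allI impI)
      fix y :: 'a assume y: "0 \<le> y"
      have "(\<lambda>N. h N y) \<longlonglongrightarrow> s y - s y"
        unfolding h using s[of y] by (intro tendsto_diff tendsto_const) (simp add: sums_def)
      then have "z y \<le> s y - s y"
        using z y by (intro LIMSEQ_le_const) (auto simp: less_eq_blinfun_def)
      then show "z y \<le> (0 :: 'a \<Rightarrow>\<^sub>L real) y" by simp
    qed
    then have "decreases_to_0 UNIV (\<le>) h"
      using h_mono h_pos unfolding decreases_to_0_def less_eq_blinfun_def by auto
    moreover have "directed_set (UNIV :: nat set) (\<le>)"
      unfolding directed_set_def
      by (auto simp: reflp_on_def transp_on_def intro: max.cobounded1 max.cobounded2)
    ultimately have "decreases_to_0 UNIV (\<le>) (\<lambda>N. norm (h N))"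
      using order_continuous_norm_net[OF ocn] by blast
    then have small: "\<exists>N. norm (h N) < e" if "0 < e" for e
      using that unfolding decreases_to_0_def by (meson UNIV_I not_le)
    show ?thesis
    proof (rule LIMSEQ_I)
      fix e :: real assume "0 < e"
      then obtain N where N: "norm (h N) < e" using small by blast
      have "norm (f (w n) - 0) < e" if "N \<le> n" for n
      proof -
        have "f (w n) \<le> g n (w n)" by (rule g)
        also have "\<dots> \<le> h n (w n)"
          using h_pos[OF w(1), of "Suc n" n] by (simp add: h)
        also have "\<dots> \<le> h N (w n)" by (rule h_mono[OF that w(1)])
        also have "\<dots> \<le> norm (h N) * norm (w n)" using norm_blinfun[of "h N" "w n"] by simp
        also have "\<dots> \<le> norm (h N) * 1" using w(2) by (intro mult_left_mono) auto
        finally show ?thesis using N blinfun_nonneg[OF f w(1)[of n]] by simp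
      qed
      then show "\<exists>N. \<forall>n\<ge>N. norm (f (w n) - 0) < e" by blast
    qed
  qed
  obtain g :: "'a \<Rightarrow>\<^sub>L real" where g: "0 \<le> g" "\<And>x. 0 \<le> x \<Longrightarrow> \<bar>f x\<bar> \<le> g x"
    using functional_dominated_by_positive by metis
  show ?thesis
    using g(2) w(1) by (intro Lim_null_comparison[OF _ pos[OF g(1)]]) auto
qed

lemma norm_positive_functional_le:
  fixes f :: "'a::banach_lattice \<Rightarrow>\<^sub>L real"
  assumes "0 \<le> f" "0 \<le> c" and le: "\<And>x. 0 \<le> x \<Longrightarrow> norm x \<le> 1 \<Longrightarrow> f x \<le> c"
  shows "norm f \<le> c"
proof (rule norm_blinfun_bound[OF assms(2)])
  fix x :: 'a
  show "norm (f x) \<le> c * norm x"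
  proof (cases "x = 0")
    case False
    have "f (inverse (norm x) *\<^sub>R \<bar>x\<bar>) \<le> c"
      using False by (intro le scaleR_nonneg_nonneg) auto
    then have "f \<bar>x\<bar> \<le> c * norm x"
      using False by (simp add: blinfun.scaleR_right field_simps)
    then show ?thesis using blinfun_abs_le[OF assms(1), of x] by simp
  qed simp
qed

text \<open>
  A net of functionals that decreases to \<open>0\<close> converges to \<open>0\<close> pointwise on the positive cone, because
  its pointwise infimum is additive and thus a functional below the net. The hypothesis makes this
  convergence uniform on the unit ball.
\<close>

lemma dual_order_continuous_if_order_bounded:
  assumes bdd: "\<And>(f :: 'a::banach_lattice \<Rightarrow>\<^sub>L real) e. 0 \<le> f \<Longrightarrow> 0 < e \<Longrightarrow>
    \<exists>u\<ge>0. \<forall>x\<ge>0. norm x \<le> 1 \<longrightarrow> blinfun_apply f (pprt (x - u)) \<le> e"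
  shows "order_continuous_norm TYPE('a \<Rightarrow>\<^sub>L real)"
  unfolding order_continuous_norm_def
proof (intro allI impI)
  fix I r and \<phi> :: "('a \<Rightarrow>\<^sub>L real) \<Rightarrow> 'a \<Rightarrow>\<^sub>L real"
  assume dir: "directed_set I r" and dec: "decreases_to_0 I r \<phi>"
  have anti: "\<phi> j \<le> \<phi> i" if "i \<in> I" "j \<in> I" "r i j" for i j
    using dec that by (auto simp: decreases_to_0_def)
  have pos: "0 \<le> \<phi> i" if "i \<in> I" for i using dec that by (auto simp: decreases_to_0_def)
  obtain i0 where i0: "i0 \<in> I" using dir by (auto simp: directed_set_def)
  have upper: "\<exists>k\<in>I. \<phi> k \<le> \<phi> i \<and> \<phi> k \<le> \<phi> j" if "i \<in> I" "j \<in> I" for i j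
    using dir that anti unfolding directed_set_def by meson
  define F where "F y = (INF i\<in>I. \<phi> i y)" for y
  have lower: "F y \<le> \<phi> i y" if "i \<in> I" "0 \<le> y" for i y
    unfolding F_def using that blinfun_nonneg[OF pos] by (intro cINF_lower bdd_belowI2[of _ 0]) auto
  have greatest: "c \<le> F y" if "\<And>i. i \<in> I \<Longrightarrow> c \<le> \<phi> i y" for c y
    unfolding F_def using that i0 by (intro cINF_greatest) auto
  obtain g :: "'a \<Rightarrow>\<^sub>L real" where g: "0 \<le> g" "\<And>y. 0 \<le> y \<Longrightarrow> g y = F y"
  proof (rule positive_functional_extension[of F "norm (\<phi> i0)"])
    fix y z :: 'a assume y: "0 \<le> y" and z: "0 \<le> z"
    show "F (y + z) = F y + F z"
    proof (rule order_antisym)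
      have "F (y + z) - \<phi> i y \<le> \<phi> j z" if ij: "i \<in> I" "j \<in> I" for i j
      proof -
        obtain k where k: "k \<in> I" "\<phi> k \<le> \<phi> i" "\<phi> k \<le> \<phi> j" using upper[OF ij] by blast
        have "F (y + z) \<le> \<phi> k y + \<phi> k z"
          using lower[OF k(1), of "y + z"] y z by (simp add: blinfun.add_right)
        also have "\<dots> \<le> \<phi> i y + \<phi> j z"
          using k y z by (intro add_mono) (auto simp: less_eq_blinfun_def)
        finally show ?thesis by simp
      qed
      then have "F (y + z) - \<phi> i y \<le> F z" if "i \<in> I" for i using that by (intro greatest) auto
      then have "F (y + z) - F z \<le> F y" by (intro greatest) (auto simp: algebra_simps)
      then show "F (y + z) \<le> F y + F z" by simp
      show "F y + F z \<le> F (y + z)"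
        using lower y z by (intro greatest) (auto simp: blinfun.add_right intro: add_mono)
    qed
  next
    fix c :: real and y :: 'a assume c: "0 < c" and y: "0 \<le> y"
    have "F (c *\<^sub>R y) / c \<le> F y"
    proof (rule greatest)
      fix i assume "i \<in> I"
      then show "F (c *\<^sub>R y) / c \<le> \<phi> i y"
        using lower[of i "c *\<^sub>R y"] c y
        by (simp add: scaleR_nonneg_nonneg blinfun.scaleR_right field_simps)
    qed
    then show "F (c *\<^sub>R y) \<le> c * F y" using c by (simp add: field_simps)
  next
    fix y :: 'a assume y: "0 \<le> y"
    have "F y \<le> norm (\<phi> i0) * norm y"
      using lower[OF i0 y] norm_blinfun[of "\<phi> i0" y] by simp
    moreover have "0 \<le> F y" using blinfun_nonneg[OF pos y] by (intro greatest) auto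
    ultimately show "0 \<le> F y \<and> F y \<le> norm (\<phi> i0) * norm y" by simp
  qed (use that in auto)
  have "g \<le> \<phi> i" if "i \<in> I" for i
    using lower[OF that] g(2) by (auto simp: less_eq_blinfun_def)
  then have "g \<le> 0" using dec unfolding decreases_to_0_def by blast
  then have F0: "F y \<le> 0" if "0 \<le> y" for y
    using g(2)[OF that] that by (auto simp: less_eq_blinfun_def)
  have pointwise: "\<exists>i\<in>I. \<phi> i y < e" if "0 \<le> y" "0 < e" for y e
    using greatest[of e y] F0[OF that(1)] that(2) by (meson not_le order_trans)
  have small: "\<exists>k\<in>I. norm (\<phi> k) \<le> e" if e: "0 < e" for e
  proof -
    obtain u where u: "0 \<le> u" "\<And>x. 0 \<le> x \<Longrightarrow> norm x \<le> 1 \<Longrightarrow> \<phi> i0 (pprt (x - u)) \<le> e / 2"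
      using bdd[OF pos[OF i0] half_gt_zero[OF e]] by blast
    obtain i where i: "i \<in> I" "\<phi> i u < e / 2" using pointwise[OF u(1) half_gt_zero[OF e]] by blast
    obtain k where k: "k \<in> I" "\<phi> k \<le> \<phi> i" "\<phi> k \<le> \<phi> i0" using upper[OF i(1) i0] by blast
    have "norm (\<phi> k) \<le> e"
    proof (rule norm_positive_functional_le[OF pos[OF k(1)]])
      fix x :: 'a assume x: "0 \<le> x" "norm x \<le> 1"
      have "\<phi> k x \<le> \<phi> k (u + pprt (x - u))"
        by (intro blinfun_mono pos k(1) le_add_pprt_diff)
      also have "\<dots> \<le> \<phi> i u + \<phi> i0 (pprt (x - u))"
        using k u(1) by (auto simp: blinfun.add_right less_eq_blinfun_def intro!: add_mono)
      also have "\<dots> \<le> e" using i(2) u(2)[OF x] by simp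
      finally show "\<phi> k x \<le> e" .
    qed (use e in simp)
    then show ?thesis using k(1) by blast
  qed
  show "decreases_to_0 I r (\<lambda>i. norm (\<phi> i))"
    unfolding decreases_to_0_def
  proof (intro conjI ballI allI impI)
    fix i j assume ij: "i \<in> I" "j \<in> I" "r i j"
    show "norm (\<phi> j) \<le> norm (\<phi> i)"
    proof (rule norm_positive_functional_le[OF pos[OF ij(2)]])
      fix x :: 'a assume x: "0 \<le> x" "norm x \<le> 1"
      have "\<phi> j x \<le> \<phi> i x" using anti[OF ij] x by (auto simp: less_eq_blinfun_def)
      also have "\<dots> \<le> norm (\<phi> i) * norm x" using norm_blinfun[of "\<phi> i" x] by simp
      also have "\<dots> \<le> norm (\<phi> i) * 1" using x by (intro mult_left_mono) auto
      finally show "\<phi> j x \<le> norm (\<phi> i)" by simp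
    qed simp
  next
    fix z assume z: "\<forall>i\<in>I. z \<le> norm (\<phi> i)"
    show "z \<le> 0"
    proof (rule field_le_epsilon)
      fix e :: real assume "0 < e"
      then obtain k where "k \<in> I" "norm (\<phi> k) \<le> e" using small by blast
      then show "z \<le> 0 + e" using z by auto
    qed
  qed auto
qed

section \<open>Order continuity of the dual norm implies semi-compactness\<close>

text \<open>
  A positive weakly null sequence need not be norm null, but an L-weakly compact one is.
  If \<open>\<parallel>y\<^sub>n\<parallel> \<ge> c > 0\<close> for infinitely many \<open>n\<close>, choose positive norming functionals \<open>\<phi>\<^sub>n\<close>. On a rapidly
  increasing subsequence \<open>\<phi>\<^sub>k(y\<^sub>j)\<close> is tiny for \<open>j > k\<close>, so subtracting \<open>4\<^sup>j y\<^sub>j\<close> for all later \<open>j\<close> and a small multiple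
  of the earlier terms from \<open>y\<^sub>k\<close> hardly changes the value of \<open>\<phi>\<^sub>k\<close> and makes the positive parts
  disjoint. The series of the subtracted later terms may diverge, but its
  partial sums yield decreasing positive parts, which converge by order continuity.
\<close>

lemma positive_weakly_null_L_weakly_compact_null:
  fixes y :: "nat \<Rightarrow> 'a::banach_lattice"
  assumes ocn: "order_continuous_norm TYPE('a)"
    and y: "\<And>n. 0 \<le> y n"
    and null: "\<And>f :: 'a \<Rightarrow>\<^sub>L real. (\<lambda>n. f (y n)) \<longlonglongrightarrow> 0"
    and L: "L_weakly_compact (range y)"
  shows "y \<longlonglongrightarrow> 0"
proof (rule ccontr)
  assume "\<not> y \<longlonglongrightarrow> 0"
  then obtain c where c: "0 < c" "\<And>N. \<exists>n\<ge>N. c \<le> norm (y n)"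
    unfolding LIMSEQ_iff by (auto simp: not_less)
  obtain M where M: "\<And>n. norm (y n) \<le> M"
    using L by (auto simp: L_weakly_compact_def bounded_iff)
  have "\<exists>f :: 'a \<Rightarrow>\<^sub>L real. 0 \<le> f \<and> blinfun_apply f (y n) = norm (y n) \<and>
    (\<forall>x. blinfun_apply f x \<le> norm x)" for n
    using positive_norming_functional[OF y] by metis
  then obtain \<phi> :: "nat \<Rightarrow> 'a \<Rightarrow>\<^sub>L real" where \<phi>: "\<And>n. 0 \<le> \<phi> n"
    "\<And>n. \<phi> n (y n) = norm (y n)" "\<And>n x. \<phi> n x \<le> norm x" by metis
  (* The factor 1/8 leaves a geometric series after multiplication by the 4 ^ j below. *)
  have "\<exists>s. \<forall>j. c \<le> norm (y (s j)) \<and>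
    (s j < s (Suc j) \<and> (\<forall>i\<le>s j. \<phi> i (y (s (Suc j))) \<le> c * (1/8) ^ Suc j))"
  proof (rule dependent_nat_choice)
    show "\<exists>n. c \<le> norm (y n)" using c(2) by blast
    fix m j
    have "0 < c * (1/8) ^ Suc j" using c(1) by simp
    then have "\<forall>i\<in>{..m}. \<forall>\<^sub>F n in sequentially. \<phi> i (y n) < c * (1/8) ^ Suc j"
      using order_tendstoD(2)[OF null] by blast
    then have "\<forall>\<^sub>F n in sequentially. \<forall>i\<in>{..m}. \<phi> i (y n) < c * (1/8) ^ Suc j"
      by (intro eventually_ball_finite) auto
    then obtain N where N: "\<And>n i. N \<le> n \<Longrightarrow> i \<le> m \<Longrightarrow> \<phi> i (y n) < c * (1/8) ^ Suc j"
      unfolding eventually_sequentially by blast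
    obtain n where "max N (Suc m) \<le> n" "c \<le> norm (y n)" using c(2) by blast
    then show "\<exists>n. c \<le> norm (y n) \<and> (m < n \<and> (\<forall>i\<le>m. \<phi> i (y n) \<le> c * (1/8) ^ Suc j))"
      using N by (intro exI[of _ n]) (auto intro: less_imp_le)
  qed
  then obtain s where s: "\<And>j. c \<le> norm (y (s j))" "\<And>j. s j < s (Suc j)"
    "\<And>i j. i \<le> s j \<Longrightarrow> \<phi> i (y (s (Suc j))) \<le> c * (1/8) ^ Suc j" by blast
  have "strict_mono s" using s(2) by (simp add: strict_mono_Suc_iff)
  then have later: "\<phi> (s k) (y (s j)) \<le> c * (1/8) ^ j" if "k < j" for k j
    using s(3)[of "s k" "j - 1"] that by (simp add: strict_mono_less_eq)
  define p where "p k N = pprt (y (s k) - (\<Sum>j\<in>{k<..N}. 4 ^ j *\<^sub>R y (s j))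
    - (1/4) ^ k *\<^sub>R (\<Sum>i<k. y (s i)))" for k N
  have pos: "0 \<le> (4::real) ^ j *\<^sub>R y (s j)" for j using y by (intro scaleR_nonneg_nonneg) auto
  have pos_sum: "0 \<le> (\<Sum>j\<in>J. (4::real) ^ j *\<^sub>R y (s j))" for J using pos by (intro sum_nonneg)
  have pos_sum': "0 \<le> (1/4::real) ^ k *\<^sub>R (\<Sum>i<k. y (s i))" for k
    using y by (intro scaleR_nonneg_nonneg sum_nonneg) auto
  have p_dec: "decseq (p k)" for k
  proof (rule decseq_SucI)
    fix N
    have "(\<Sum>j\<in>{k<..N}. (4::real) ^ j *\<^sub>R y (s j)) \<le> (\<Sum>j\<in>{k<..Suc N}. 4 ^ j *\<^sub>R y (s j))"
      using pos by (intro sum_mono2) auto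
    then show "p k (Suc N) \<le> p k N"
      unfolding p_def by (intro pprt_mono diff_mono order_refl)
  qed
  have p_pos: "0 \<le> p k N" for k N by (simp add: p_def)
  have "\<exists>v. p k \<longlonglongrightarrow> v \<and> 0 \<le> v \<and> (\<forall>N. v \<le> p k N)" for k
    using order_continuous_decreasing_convergent[OF ocn p_dec p_pos, of k] by metis
  then obtain v where v: "\<And>k. p k \<longlonglongrightarrow> v k" "\<And>k. 0 \<le> v k" "\<And>k N. v k \<le> p k N" by metis
  have v_le: "v k \<le> y (s k)" for k
  proof -
    have "p k 0 \<le> pprt (y (s k))"
      unfolding p_def using pos_sum pos_sum'[of k]
      by (intro pprt_mono) (simp add: diff_le_eq add_increasing2 add_increasing)
    then show ?thesis using v(3)[of k 0] y[of "s k"] by (simp add: order_trans)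
  qed
  have disj: "inf (v k) (v j) = 0" if "k < j" for k j
  proof (rule disjoint_if_le_pprt_diff)
    show "1 \<le> (4::real) ^ j" by simp
    show "0 \<le> v k" "0 \<le> v j" by (fact v)+
    have "4 ^ j *\<^sub>R y (s j) \<le> (\<Sum>i\<in>{k<..j}. (4::real) ^ i *\<^sub>R y (s i))"
      using that pos sum_mono2[of "{k<..j}" "{j}" "\<lambda>i. 4 ^ i *\<^sub>R y (s i)"] by auto
    then have "y (s k) - (\<Sum>i\<in>{k<..j}. 4 ^ i *\<^sub>R y (s i)) - (1/4) ^ k *\<^sub>R (\<Sum>i<k. y (s i))
      \<le> y (s k) - 4 ^ j *\<^sub>R y (s j) - 0"
      by (intro diff_mono order_refl pos_sum')
    then have "p k j \<le> pprt (y (s k) - 4 ^ j *\<^sub>R y (s j))"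
      unfolding p_def by (intro pprt_mono) simp
    then show "v k \<le> pprt (y (s k) - 4 ^ j *\<^sub>R y (s j))" using v(3) order_trans by blast
    have "y (s k) \<le> (\<Sum>i<j. y (s i))"
      using that y sum_mono2[of "{..<j}" "{k}" "\<lambda>i. y (s i)"] by auto
    then have "inverse (4 ^ j) *\<^sub>R y (s k) \<le> (1/4) ^ j *\<^sub>R (\<Sum>i<j. y (s i))"
      by (simp add: power_one_over inverse_eq_divide scaleR_left_mono)
    then have "y (s j) - (\<Sum>i\<in>{j<..j}. 4 ^ i *\<^sub>R y (s i)) - (1/4) ^ j *\<^sub>R (\<Sum>i<j. y (s i))
      \<le> y (s j) - 0 - inverse (4 ^ j) *\<^sub>R y (s k)"
      by (intro diff_mono order_refl pos_sum)
    then have "p j j \<le> pprt (y (s j) - inverse (4 ^ j) *\<^sub>R y (s k))"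
      unfolding p_def by (intro pprt_mono) simp
    then show "v j \<le> pprt (y (s j) - inverse (4 ^ j) *\<^sub>R y (s k))" using v(3) order_trans by blast
  qed
  have v_large: "c - (1/2) ^ k * (c + M) \<le> norm (v k)" for k
  proof -
    have "c - (1/2) ^ k * (c + M) \<le> \<phi> (s k) (p k N)" if "k \<le> N" for N
    proof -
      have geom: "(\<Sum>j\<in>{k<..N}. (1/2::real) ^ j) = (1/2) ^ k - (1/2) ^ N"
        using that
      proof (induction N rule: dec_induct)
        case (step n)
        then have "{k<..Suc n} = insert (Suc n) {k<..n}" by auto
        with step show ?case by simp
      qed simp
      have "\<phi> (s k) (\<Sum>j\<in>{k<..N}. 4 ^ j *\<^sub>R y (s j)) = (\<Sum>j\<in>{k<..N}. 4 ^ j * \<phi> (s k) (y (s j)))"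
        by (simp add: blinfun.sum_right blinfun.scaleR_right)
      also have "\<dots> \<le> (\<Sum>j\<in>{k<..N}. 4 ^ j * (c * (1/8) ^ j))"
        using later by (intro sum_mono mult_left_mono) auto
      also have "\<dots> = (\<Sum>j\<in>{k<..N}. c * (1/2) ^ j)"
        by (intro sum.cong) (auto simp: power_divide power_mult_distrib[symmetric] field_simps)
      also have "\<dots> = c * ((1/2) ^ k - (1/2) ^ N)" by (simp add: sum_distrib_left[symmetric] geom)
      also have "\<dots> \<le> c * (1/2) ^ k" using c(1) by simp
      finally have 1: "\<phi> (s k) (\<Sum>j\<in>{k<..N}. 4 ^ j *\<^sub>R y (s j)) \<le> c * (1/2) ^ k" .
      have M0: "0 \<le> M" using M[of 0] norm_ge_zero order_trans by blast
      have "\<phi> (s k) ((1/4) ^ k *\<^sub>R (\<Sum>i<k. y (s i))) = (1/4) ^ k * (\<Sum>i<k. \<phi> (s k) (y (s i)))"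
        by (simp add: blinfun.sum_right blinfun.scaleR_right)
      also have "\<dots> \<le> (1/4) ^ k * (\<Sum>i<k. M)"
        using \<phi>(3) M by (intro mult_left_mono sum_mono) (auto intro: order_trans)
      also have "\<dots> = (1/4) ^ k * real k * M" by simp
      also have "\<dots> \<le> (1/4) ^ k * 2 ^ k * M"
        using M0 of_nat_less_two_power[of k, where 'a=real]
        by (intro mult_right_mono mult_left_mono) auto
      also have "\<dots> = (1/2) ^ k * M" by (simp add: power_mult_distrib[symmetric])
      finally have 2: "\<phi> (s k) ((1/4) ^ k *\<^sub>R (\<Sum>i<k. y (s i))) \<le> (1/2) ^ k * M" .
      have "c - (1/2) ^ k * (c + M) = c - c * (1/2) ^ k - (1/2) ^ k * M"
        by (simp add: algebra_simps)
      also have "\<dots> \<le> \<phi> (s k) (y (s k) - (\<Sum>j\<in>{k<..N}. 4 ^ j *\<^sub>R y (s j))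
        - (1/4) ^ k *\<^sub>R (\<Sum>i<k. y (s i)))"
        using 1 2 s(1)[of k] \<phi>(2)[of "s k"]
        unfolding blinfun.diff_right by linarith
      also have "\<dots> \<le> \<phi> (s k) (p k N)"
        unfolding p_def by (intro blinfun_mono \<phi>(1)) (simp add: pprt_def)
      finally show ?thesis .
    qed
    moreover have "(\<lambda>N. \<phi> (s k) (p k N)) \<longlonglongrightarrow> \<phi> (s k) (v k)"
      by (intro tendsto_intros v(1))
    ultimately have "c - (1/2) ^ k * (c + M) \<le> \<phi> (s k) (v k)"
      by (intro LIMSEQ_le_const) auto
    then show ?thesis using \<phi>(3)[of "s k" "v k"] by simp
  qed
  have "disjoint_seq v"
    unfolding disjoint_seq_def
  proof (intro allI impI)
    fix m n :: nat assume "m \<noteq> n"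
    then show "inf \<bar>v m\<bar> \<bar>v n\<bar> = 0"
      using disj[of m n] disj[of n m] v(2) by (cases "m < n") (auto simp: inf_commute)
  qed
  moreover have "range v \<subseteq> solid_hull (range y)"
    using v(2) v_le y by (fastforce simp: solid_hull_def)
  ultimately have "(\<lambda>k. norm (v k)) \<longlonglongrightarrow> 0" using L by (auto simp: L_weakly_compact_def)
  moreover have "(\<lambda>k. c - (1/2) ^ k * (c + M)) \<longlonglongrightarrow> c - 0 * (c + M)"
    by (intro tendsto_intros LIMSEQ_realpow_zero) auto
  ultimately have "c - 0 * (c + M) \<le> 0"
    using v_large by (intro LIMSEQ_le) auto
  then show False using c(1) by simp
qed

text \<open>
  Since \<open>\<bar>T x\<bar> \<le> T u + T (\<bar>x\<bar> - u)\<^sup>+\<close>, the Riesz decomposition of \<open>T x\<close> along the two summands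
  gives a part in \<open>[-T u, T u]\<close> and a part of small norm.
\<close>

lemma semi_compact_if_order_bounded:
  fixes T :: "'a::banach_lattice \<Rightarrow>\<^sub>L 'b::banach_lattice"
  assumes T: "0 \<le> T"
    and bdd: "\<And>e. 0 < e \<Longrightarrow> \<exists>u\<ge>0. \<forall>x\<ge>0. norm x \<le> 1 \<longrightarrow> norm (T (pprt (x - u))) \<le> e"
  shows "semi_compact T"
  unfolding semi_compact_def
proof (intro allI impI)
  fix e :: real assume e: "0 < e"
  then obtain u where u: "0 \<le> u" "\<And>x. 0 \<le> x \<Longrightarrow> norm x \<le> 1 \<Longrightarrow> norm (T (pprt (x - u))) \<le> e"
    using bdd by blast
  have "T x \<in> {y + e *\<^sub>R b | y b. y \<in> {- T u..T u} \<and> b \<in> cball 0 1}" if x: "norm x \<le> 1" for x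
  proof -
    have "\<bar>T x\<bar> \<le> T \<bar>x\<bar>" by (rule blinfun_abs_le[OF T])
    also have "\<dots> \<le> T (u + pprt (\<bar>x\<bar> - u))" by (intro blinfun_mono T le_add_pprt_diff)
    finally have "\<bar>T x\<bar> \<le> T u + T (pprt (\<bar>x\<bar> - u))" by (simp add: blinfun.add_right)
    then obtain a b where ab: "T x = a + b" "\<bar>a\<bar> \<le> T u" "\<bar>b\<bar> \<le> T (pprt (\<bar>x\<bar> - u))"
      by (rule riesz_decomposition[OF blinfun_nonneg[OF T u(1)] blinfun_nonneg[OF T zero_le_pprt]])
    have "norm b \<le> e"
      using norm_mono_nonneg[OF abs_ge_zero ab(3)] u(2)[of "\<bar>x\<bar>"] x by simp
    then have "inverse e *\<^sub>R b \<in> cball 0 1" using e by (simp add: field_simps)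
    moreover have "T x = a + e *\<^sub>R (inverse e *\<^sub>R b)" using ab(1) e by simp
    moreover have "a \<in> {- T u..T u}" using ab(2) by (auto simp: abs_le_iff minus_le_iff)
    ultimately show ?thesis by blast
  qed
  then have "T ` cball 0 1 \<subseteq> {y + e *\<^sub>R b | y b. y \<in> {- T u..T u} \<and> b \<in> cball 0 1}" by auto
  moreover have "0 \<le> T u" by (rule blinfun_nonneg[OF T u(1)])
  ultimately show "\<exists>u\<ge>0. T ` cball 0 1 \<subseteq> {y + e *\<^sub>R b | y b. y \<in> {- u..u} \<and> b \<in> cball 0 1}"
    by blast
qed

text \<open>
  If \<open>T\<close> were not semi-compact, \<open>\<parallel>T w\<^sub>n\<parallel>\<close> would be bounded below for some disjoint \<open>w\<^sub>n\<close> in the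
  unit ball. But \<open>w\<^sub>n\<close> is weakly null, so \<open>T w\<^sub>n\<close> is positive, weakly null and L-weakly compact.
\<close>

proposition almost_L_weakly_compact_imp_semi_compact:
  fixes T :: "'a::banach_lattice \<Rightarrow>\<^sub>L 'b::banach_lattice"
  assumes ocn: "order_continuous_norm TYPE('b)"
    and dual: "order_continuous_norm TYPE('a \<Rightarrow>\<^sub>L real)"
    and T: "0 \<le> T" "almost_L_weakly_compact T"
  shows "semi_compact T"
proof (rule semi_compact_if_order_bounded[OF T(1)], rule ccontr)
  fix e :: real
  assume e: "0 < e" and "\<not> (\<exists>u\<ge>0. \<forall>x\<ge>0. norm x \<le> 1 \<longrightarrow> norm (T (pprt (x - u))) \<le> e)"
  then have large: "\<forall>u\<ge>0. \<exists>x\<ge>0. norm x \<le> 1 \<and> e < norm (T (pprt (x - u)))"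
    by (meson not_le)
  obtain w :: "nat \<Rightarrow> 'a" where w: "\<And>n. 0 \<le> w n" "\<And>n. norm (w n) \<le> 1" "\<And>n. e / 2 < norm (T (w n))"
    "\<And>m n. m \<noteq> n \<Longrightarrow> inf (w m) (w n) = 0"
    using disjoint_sequence_if_not_order_bounded[OF T(1) e large] by metis
  have null: "(\<lambda>n. f (w n)) \<longlonglongrightarrow> 0" for f :: "'a \<Rightarrow>\<^sub>L real"
    by (intro dual_order_continuous_disjoint_weakly_null[OF dual w(1,2,4)])
  have "relatively_weakly_compact (range w)"
    by (rule relatively_weakly_compact_range[of w 0]) (simp add: null)
  then have "L_weakly_compact (T ` range w)"
    using T(2) unfolding almost_L_weakly_compact_def by blast
  then have "L_weakly_compact (range (\<lambda>n. T (w n)))" by (simp add: image_image)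
  moreover have "(\<lambda>n. f (T (w n))) \<longlonglongrightarrow> 0" for f :: "'b \<Rightarrow>\<^sub>L real"
    using null[of "f o\<^sub>L T"] by simp
  ultimately have "(\<lambda>n. T (w n)) \<longlonglongrightarrow> 0"
    using w(1) by (intro positive_weakly_null_L_weakly_compact_null[OF ocn] blinfun_nonneg T)
  then have "(\<lambda>n. norm (T (w n))) \<longlonglongrightarrow> 0" by (rule tendsto_norm_zero)
  then have "e / 2 \<le> 0"
    using w(3) by (intro LIMSEQ_le_const) (auto intro: less_imp_le)
  then show False using e by simp
qed

section \<open>An almost L-weakly compact operator that is not semi-compact\<close>

text \<open>
  The Schur property of \<open>\<ell>\<^sup>1\<close>, proved by a gliding hump. If the tails were not uniformly small on
  \<open>A\<close>, there would be \<open>a\<^sub>j \<in> A\<close>, a weak cluster point \<open>l\<close> and consecutive blocks of indices such that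
  the coordinates of \<open>b\<^sub>j = a\<^sub>j - l\<close> are concentrated on the \<open>j\<close>-th block. The functional whose
  signs on that block are those of \<open>b\<^sub>j\<close> stays away from \<open>0\<close> on all \<open>b\<^sub>j\<close>. But the coordinates of
  \<open>b\<^sub>j\<close> tend to \<open>0\<close>, so \<open>l\<close> and every cluster point of \<open>(a\<^sub>j)\<close> have equal coordinates, and
  hence equal values under this functional.
\<close>

lemma dominated_functionals_uniformly_small_tails:
  fixes f :: "'a::banach_lattice \<Rightarrow>\<^sub>L real" and g :: "nat \<Rightarrow> 'a \<Rightarrow>\<^sub>L real"
  assumes g: "\<And>n. 0 \<le> g n" and sum_le: "\<And>N y. 0 \<le> y \<Longrightarrow> (\<Sum>n<N. g n y) \<le> f y"
    and A: "relatively_weakly_compact A" and \<epsilon>: "0 < \<epsilon>"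
  shows "\<exists>N. \<forall>a\<in>A. (\<Sum>n. \<bar>g (n + N) a\<bar>) \<le> \<epsilon>"
proof (rule ccontr)
  assume "\<not> ?thesis"
  then have "\<forall>N. \<exists>a. a \<in> A \<and> \<epsilon> < (\<Sum>n. \<bar>g (n + N) a\<bar>)" by (meson not_le)
  then obtain a where a: "\<And>N. a N \<in> A" "\<And>N. \<epsilon> < (\<Sum>n. \<bar>g (n + N) (a N)\<bar>)" by metis
  define tail where "tail N x = (\<Sum>n. \<bar>g (n + N) x\<bar>)" for N x
  note sm = dominated_functionals_summable(1)[OF g sum_le]
  have sm_shift: "summable (\<lambda>n. \<bar>g (n + N) x\<bar>)" for N x
    using sm[of x] summable_iff_shift[of "\<lambda>n. \<bar>g n x\<bar>" N] by simp
  have tail_split: "tail N x = (\<Sum>n\<in>{N..<N'}. \<bar>g n x\<bar>) + tail N' x" if "N \<le> N'" for N N' x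
  proof -
    have *: "tail K x = (\<Sum>n. \<bar>g n x\<bar>) - (\<Sum>n<K. \<bar>g n x\<bar>)" for K
      unfolding tail_def using suminf_split_initial_segment[OF sm[of x], of K] by simp
    have "(\<Sum>n<N'. \<bar>g n x\<bar>) = (\<Sum>n<N. \<bar>g n x\<bar>) + (\<Sum>n\<in>{N..<N'}. \<bar>g n x\<bar>)"
      using sum.atLeastLessThan_concat[of 0 N N' "\<lambda>n. \<bar>g n x\<bar>"] that by (simp add: atLeast0LessThan)
    then show ?thesis by (simp add: *)
  qed
  have tail_nonneg: "0 \<le> tail N x" for N x
    unfolding tail_def by (intro suminf_nonneg sm_shift) simp
  have tail_anti: "tail N' x \<le> tail N x" if "N \<le> N'" for N N' x
    using tail_split[OF that, of x] by (simp add: sum_nonneg)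
  have tail_diff: "tail N x \<le> tail N (x - y) + tail N y" for N x y
  proof -
    have "tail N x \<le> (\<Sum>n. \<bar>g (n + N) (x - y)\<bar> + \<bar>g (n + N) y\<bar>)"
      unfolding tail_def
      by (intro suminf_le sm_shift summable_add) (simp add: blinfun.diff_right)
    also have "\<dots> = tail N (x - y) + tail N y"
      unfolding tail_def by (intro suminf_add[symmetric] sm_shift)
    finally show ?thesis .
  qed
  have tail_small: "\<exists>N. \<forall>n\<ge>N. tail n x < e" if "0 < e" for x e
    using suminf_exist_split[OF that sm[of x]] tail_nonneg by (auto simp: tail_def)
  obtain l where l: "\<And>F e m. finite F \<Longrightarrow> 0 < e \<Longrightarrow>
      \<exists>k\<ge>m. \<forall>f\<in>F. \<bar>blinfun_apply f (a k) - blinfun_apply f l\<bar> < (e :: real)"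
    using weak_cluster_point[of A a, OF A a(1)] by blast
  obtain N0 where N0: "\<And>n. N0 \<le> n \<Longrightarrow> tail n l < \<epsilon> / 8"
    using tail_small[of "\<epsilon> / 8" l] \<epsilon> by auto
  (* The head bound is used twice: its sum over n < N is small, and it tends to 0 as N grows. *)
  define ok where "ok N k \<longleftrightarrow> N0 \<le> N \<and> 7 / 8 * \<epsilon> < tail N (a k - l) \<and>
    (\<forall>n<N. \<bar>g n (a k - l)\<bar> < \<epsilon> / 8 / (real N + 1))" for N k
  have ex_ok: "\<exists>k. ok N k" if "N0 \<le> N" for N
  proof -
    have "0 < \<epsilon> / 8 / (real N + 1)" using \<epsilon> by (simp add: add_nonneg_pos)
    then obtain k where k: "N \<le> k" "\<forall>f\<in>g ` {..<N}. \<bar>f (a k) - f l\<bar> < \<epsilon> / 8 / (real N + 1)"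
      using l[of "g ` {..<N}" "\<epsilon> / 8 / (real N + 1)" N] by auto
    have "\<epsilon> < tail k (a k)" using a(2)[of k] by (simp add: tail_def)
    also have "\<dots> \<le> tail N (a k)" by (rule tail_anti[OF k(1)])
    also have "\<dots> \<le> tail N (a k - l) + tail N l" by (rule tail_diff)
    finally have "7 / 8 * \<epsilon> < tail N (a k - l)" using N0[OF that] by simp
    then show ?thesis
      using k(2) that by (intro exI[of _ k]) (simp add: ok_def blinfun.diff_right)
  qed
  have "\<exists>s. \<forall>j. ok (fst (s j)) (snd (s j)) \<and>
    (fst (s j) < fst (s (Suc j)) \<and> tail (fst (s (Suc j))) (a (snd (s j)) - l) < \<epsilon> / 8)"
  proof (rule dependent_nat_choice)
    show "\<exists>x. ok (fst x) (snd x)" using ex_ok[of N0] by auto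
    fix x :: "nat \<times> nat" and j :: nat assume x: "ok (fst x) (snd x)"
    obtain N where N: "\<And>n. N \<le> n \<Longrightarrow> tail n (a (snd x) - l) < \<epsilon> / 8"
      using tail_small[of "\<epsilon> / 8"] \<epsilon> by auto
    define N' where "N' = max N (Suc (fst x))"
    have "N0 \<le> N'" using x by (auto simp: N'_def ok_def)
    then obtain k where "ok N' k" using ex_ok by blast
    then show "\<exists>z. ok (fst z) (snd z) \<and> (fst x < fst z \<and> tail (fst z) (a (snd x) - l) < \<epsilon> / 8)"
      using N by (intro exI[of _ "(N', k)"]) (auto simp: N'_def)
  qed
  then obtain s where s: "\<And>j. ok (fst (s j)) (snd (s j))" "\<And>j. fst (s j) < fst (s (Suc j))"
    "\<And>j. tail (fst (s (Suc j))) (a (snd (s j)) - l) < \<epsilon> / 8" by blast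
  define N where "N j = fst (s j)" for j
  define b where "b j = a (snd (s j)) - l" for j
  have N: "strict_mono N" using s(2) by (simp add: strict_mono_Suc_iff N_def)
  have b: "7 / 8 * \<epsilon> < tail (N j) (b j)" "tail (N (Suc j)) (b j) < \<epsilon> / 8"
    "\<And>n. n < N j \<Longrightarrow> \<bar>g n (b j)\<bar> < \<epsilon> / 8 / (real (N j) + 1)" for j
    using s(1)[of j] s(3)[of j] by (auto simp: ok_def N_def b_def)
  \<comment> \<open>the index of the block that contains \<open>n\<close>\<close>
  define blk where "blk n = (LEAST j. n < N (Suc j))" for n
  have blk: "blk n = j" if "N j \<le> n" "n < N (Suc j)" for n j
    unfolding blk_def
  proof (rule Least_equality)
    show "n < N (Suc j)" by fact
    show "j \<le> i" if "n < N (Suc i)" for i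
    proof (rule ccontr)
      assume "\<not> j \<le> i"
      then have "N (Suc i) \<le> N j" using N by (simp add: strict_mono_less_eq)
      then show False using that \<open>N j \<le> n\<close> by simp
    qed
  qed
  define \<sigma> where "\<sigma> n = sgn (g n (b (blk n)))" for n
  have \<sigma>: "\<bar>\<sigma> n\<bar> \<le> 1" for n by (simp add: \<sigma>_def abs_sgn_eq)
  obtain h :: "'a \<Rightarrow>\<^sub>L real" where h: "\<And>y. (\<lambda>n. g n y *\<^sub>R \<sigma> n) sums h y"
    using dominated_functionals_series[of g f \<sigma>, OF g sum_le] \<sigma> by auto
  have h_large: "\<epsilon> / 2 \<le> h (b j)" for j
  proof -
    let ?x = "b j"
    have le: "\<bar>g n ?x * \<sigma> n\<bar> \<le> \<bar>g n ?x\<bar>" for n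
      using mult_left_mono[OF \<sigma>[of n], of "\<bar>g n ?x\<bar>"] by (simp add: abs_mult)
    have h_eq: "h ?x = (\<Sum>n<N (Suc j). g n ?x * \<sigma> n) + (\<Sum>n. g (n + N (Suc j)) ?x * \<sigma> (n + N (Suc j)))"
      using suminf_split_initial_segment[OF sums_summable[OF h[of ?x]], of "N (Suc j)"]
      by (simp add: sums_unique[OF h[of ?x]] add.commute)
    have split: "(\<Sum>n<N (Suc j). g n ?x * \<sigma> n)
      = (\<Sum>n<N j. g n ?x * \<sigma> n) + (\<Sum>n\<in>{N j..<N (Suc j)}. g n ?x * \<sigma> n)"
      using sum.atLeastLessThan_concat[of 0 "N j" "N (Suc j)" "\<lambda>n. g n ?x * \<sigma> n"] N
      by (simp add: atLeast0LessThan strict_mono_less_eq)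
    have "\<bar>\<Sum>n<N j. g n ?x * \<sigma> n\<bar> \<le> (\<Sum>n<N j. \<epsilon> / 8 / (real (N j) + 1))"
      using b(3)[of _ j] le by (intro order_trans[OF sum_abs] sum_mono) (fastforce intro: order_trans less_imp_le)
    also have "\<dots> = \<epsilon> / 8 * (real (N j) / (real (N j) + 1))" by simp
    also have "\<dots> \<le> \<epsilon> / 8 * 1" using \<epsilon> by (intro mult_left_mono) auto
    finally have head: "\<bar>\<Sum>n<N j. g n ?x * \<sigma> n\<bar> \<le> \<epsilon> / 8" by simp
    have block: "(\<Sum>n\<in>{N j..<N (Suc j)}. g n ?x * \<sigma> n) = (\<Sum>n\<in>{N j..<N (Suc j)}. \<bar>g n ?x\<bar>)"
      by (intro sum.cong refl) (simp add: \<sigma>_def blk[of j] abs_sgn)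
    have "\<bar>\<Sum>n. g (n + N (Suc j)) ?x * \<sigma> (n + N (Suc j))\<bar> \<le> tail (N (Suc j)) ?x"
      using norm_suminf_le[OF _ sm_shift, of "\<lambda>n. g (n + N (Suc j)) ?x * \<sigma> (n + N (Suc j))"] le
      by (simp add: tail_def)
    moreover have "N j \<le> N (Suc j)" using N by (simp add: strict_mono_less_eq)
    ultimately show ?thesis
      using h_eq split head block tail_split[of "N j" "N (Suc j)" ?x] b(1,2)[of j] by linarith
  qed
  obtain l' where l': "\<And>F e m. finite F \<Longrightarrow> 0 < e \<Longrightarrow>
      \<exists>k\<ge>m. \<forall>f\<in>F. \<bar>blinfun_apply f (a (snd (s k))) - blinfun_apply f l'\<bar> < (e :: real)"
    using weak_cluster_point[of A "\<lambda>j. a (snd (s j))", OF A a(1)] by blast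
  have "g n l' = g n l" for n
  proof (rule ccontr)
    assume "g n l' \<noteq> g n l"
    then have d: "0 < \<bar>g n l' - g n l\<bar> / 2" by simp
    obtain m :: nat where m: "\<epsilon> / 8 / (\<bar>g n l' - g n l\<bar> / 2) \<le> real m" using real_arch_simple by blast
    obtain j where j: "max m (Suc n) \<le> j" "\<bar>g n (a (snd (s j))) - g n l'\<bar> < \<bar>g n l' - g n l\<bar> / 2"
      using l'[of "{g n}" "\<bar>g n l' - g n l\<bar> / 2" "max m (Suc n)"] d by auto
    have "j \<le> N j" by (rule strict_mono_imp_increasing[OF N])
    then have "n < N j" "real m \<le> real (N j) + 1" using j(1) by auto
    then have "\<epsilon> / 8 \<le> (\<bar>g n l' - g n l\<bar> / 2) * (real (N j) + 1)"
      using m d by (smt (verit) mult_left_mono pos_divide_le_eq mult.commute)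
    then have "\<epsilon> / 8 / (real (N j) + 1) \<le> \<bar>g n l' - g n l\<bar> / 2"
      by (subst pos_divide_le_eq) (simp_all add: add_nonneg_pos)
    then have "\<bar>g n (a (snd (s j))) - g n l\<bar> < \<bar>g n l' - g n l\<bar> / 2"
      using b(3)[OF \<open>n < N j\<close>] unfolding b_def blinfun.diff_right by linarith
    then show False
      using j(2) abs_triangle_ineq4[of "g n (a (snd (s j))) - g n l" "g n (a (snd (s j))) - g n l'"]
      by simp
  qed
  then have "h l' = h l" using h[of l'] h[of l] by (simp add: sums_unique2)
  moreover obtain j where "\<bar>h (a (snd (s j))) - h l'\<bar> < \<epsilon> / 4"
    using l'[of "{h}" "\<epsilon> / 4" 0] \<epsilon> by auto
  ultimately show False
    using h_large[of j] \<epsilon> by (simp add: b_def blinfun.diff_right abs_less_iff)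
qed

text \<open>
  By uniform smallness of the tails, the image of a relatively weakly compact set is contained
  in an order interval up to elements of small norm. Disjoint sequences in order intervals are norm
  null because the norm is order continuous.
\<close>

lemma series_operator_almost_L_weakly_compact:
  fixes f :: "'a::banach_lattice \<Rightarrow>\<^sub>L real" and g :: "nat \<Rightarrow> 'a \<Rightarrow>\<^sub>L real"
    and T :: "'a \<Rightarrow>\<^sub>L 'b::banach_lattice"
  assumes ocn: "order_continuous_norm TYPE('b)"
    and g: "\<And>n. 0 \<le> g n" and sum_le: "\<And>N y. 0 \<le> y \<Longrightarrow> (\<Sum>n<N. g n y) \<le> f y"
    and w: "\<And>n. 0 \<le> w n" "\<And>n. norm (w n) \<le> 1"
    and T: "\<And>y. (\<lambda>n. g n y *\<^sub>R w n) sums T y"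
  shows "almost_L_weakly_compact T"
  unfolding almost_L_weakly_compact_def
proof (intro allI impI)
  fix A :: "'a set" assume "A \<noteq> {}" and A: "relatively_weakly_compact A"
  note sm = dominated_functionals_summable(1)[OF g sum_le]
  have approx: "\<exists>u\<ge>0. \<forall>a\<in>A. \<exists>r. \<bar>T a\<bar> \<le> u + \<bar>r\<bar> \<and> norm r \<le> e" if e: "0 < e" for e
  proof -
    obtain N where N: "\<And>a. a \<in> A \<Longrightarrow> (\<Sum>n. \<bar>g (n + N) a\<bar>) \<le> e"
      using dominated_functionals_uniformly_small_tails[OF g sum_le A e] by blast
    have "\<exists>M. 0 \<le> M \<and> (\<forall>a\<in>A. \<bar>g n a\<bar> \<le> M)" for n
      using relatively_weakly_compact_bounded_functional[OF A] by metis
    then obtain M where M: "\<And>n. 0 \<le> M n" "\<And>n a. a \<in> A \<Longrightarrow> \<bar>g n a\<bar> \<le> M n" by metis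
    define u where "u = (\<Sum>n<N. M n *\<^sub>R w n)"
    have "\<exists>r. \<bar>T a\<bar> \<le> u + \<bar>r\<bar> \<and> norm r \<le> e" if a: "a \<in> A" for a
    proof -
      define r where "r = (\<Sum>n. g (n + N) a *\<^sub>R w (n + N))"
      have le: "norm (g n a *\<^sub>R w n) \<le> \<bar>g n a\<bar>" for n
        using mult_left_mono[OF w(2)[of n], of "\<bar>g n a\<bar>"] by simp
      have Ta: "T a = (\<Sum>n<N. g n a *\<^sub>R w n) + r"
        using suminf_split_initial_segment[OF sums_summable[OF T[of a]], of N]
        by (simp add: r_def sums_unique[OF T[of a]] add.commute)
      have "\<bar>\<Sum>n<N. g n a *\<^sub>R w n\<bar> \<le> (\<Sum>n<N. \<bar>g n a *\<^sub>R w n\<bar>)" by (rule abs_sum_lattice_le)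
      also have "\<dots> \<le> u"
        unfolding u_def abs_scaleR_lattice using M(2)[OF a] w(1)
        by (intro sum_mono) (simp add: scaleR_right_mono)
      finally have "\<bar>\<Sum>n<N. g n a *\<^sub>R w n\<bar> + \<bar>r\<bar> \<le> u + \<bar>r\<bar>" by simp
      then have "\<bar>T a\<bar> \<le> u + \<bar>r\<bar>"
        unfolding Ta using abs_triangle_ineq order_trans by blast
      moreover have "norm r \<le> (\<Sum>n. \<bar>g (n + N) a\<bar>)"
        unfolding r_def using le summable_iff_shift[of "\<lambda>n. \<bar>g n a\<bar>" N] sm[of a]
        by (intro norm_suminf_le) auto
      ultimately show ?thesis using N[OF a] order_trans by blast
    qed
    moreover have "0 \<le> u" unfolding u_def using M(1) w(1) by (intro sum_nonneg scaleR_nonneg_nonneg)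
    ultimately show ?thesis by blast
  qed
  have "bounded (T ` A)"
  proof -
    obtain u where u: "\<And>a. a \<in> A \<Longrightarrow> \<exists>r. \<bar>T a\<bar> \<le> u + \<bar>r\<bar> \<and> norm r \<le> 1"
      using approx[of 1] by auto
    have "norm (T a) \<le> norm u + 1" if "a \<in> A" for a
    proof -
      obtain r where r: "\<bar>T a\<bar> \<le> u + \<bar>r\<bar>" "norm r \<le> 1" using u[OF \<open>a \<in> A\<close>] by blast
      show ?thesis
        using norm_mono_nonneg[OF abs_ge_zero r(1)] norm_triangle_ineq[of u "\<bar>r\<bar>"] r(2) by simp
    qed
    then show ?thesis unfolding bounded_iff by auto
  qed
  moreover have "(\<lambda>n. norm (y n)) \<longlonglongrightarrow> 0" if y: "disjoint_seq y" "range y \<subseteq> solid_hull (T ` A)" for y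
  proof (rule LIMSEQ_I)
    fix e :: real assume "0 < e"
    then obtain u where u: "0 \<le> u" "\<And>a. a \<in> A \<Longrightarrow> \<exists>r. \<bar>T a\<bar> \<le> u + \<bar>r\<bar> \<and> norm r \<le> e / 2"
      using approx[of "e / 2"] by auto
    have "inf (inf u \<bar>y m\<bar>) (inf u \<bar>y n\<bar>) = 0" if "m \<noteq> n" for m n
    proof (rule inf_eq_0_mono)
      show "inf \<bar>y m\<bar> \<bar>y n\<bar> = 0" using y(1) that by (simp add: disjoint_seq_def)
    qed (use u(1) in auto)
    then have "(\<lambda>n. inf u \<bar>y n\<bar>) \<longlonglongrightarrow> 0"
      using u(1) by (intro order_continuous_disjoint_null[OF ocn, of _ u]) auto
    then obtain K where K: "\<And>n. K \<le> n \<Longrightarrow> norm (inf u \<bar>y n\<bar>) < e / 2"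
      using LIMSEQ_D[of "\<lambda>n. inf u \<bar>y n\<bar>" 0 "e / 2"] \<open>0 < e\<close> by auto
    have "norm (y n) < e" if "K \<le> n" for n
    proof -
      obtain a where a: "a \<in> A" "\<bar>y n\<bar> \<le> \<bar>T a\<bar>" using y(2) by (auto simp: solid_hull_def)
      obtain r where r: "\<bar>T a\<bar> \<le> u + \<bar>r\<bar>" "norm r \<le> e / 2" using u(2)[OF a(1)] by blast
      have "\<bar>y n\<bar> = inf (u + \<bar>r\<bar>) \<bar>y n\<bar>"
        by (rule inf_absorb2[OF order_trans[OF a(2) r(1)], symmetric])
      also have "\<dots> \<le> inf u \<bar>y n\<bar> + inf \<bar>r\<bar> \<bar>y n\<bar>" using u(1) by (intro inf_add_le) auto
      also have "\<dots> \<le> inf u \<bar>y n\<bar> + \<bar>r\<bar>" by simp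
      finally have "norm \<bar>y n\<bar> \<le> norm (inf u \<bar>y n\<bar> + \<bar>r\<bar>)" by (intro norm_mono_nonneg) auto
      also have "\<dots> \<le> norm (inf u \<bar>y n\<bar>) + norm r" using norm_triangle_ineq[of _ "\<bar>r\<bar>"] by simp
      also have "\<dots> < e" using K[OF that] r(2) by simp
      finally show ?thesis by simp
    qed
    then show "\<exists>K. \<forall>n\<ge>K. norm (norm (y n) - 0) < e" by auto
  qed
  ultimately show "L_weakly_compact (T ` A)"
    using \<open>A \<noteq> {}\<close> unfolding L_weakly_compact_def by blast
qed

text \<open>
  If \<open>T\<close> mapped the unit ball into \<open>[-u, u]\<close> up to norm \<open>\<eta> / 2\<close>, then \<open>z\<^sub>n \<le> T x\<^sub>n\<close> would differ from
  \<open>inf u z\<^sub>n\<close> by at most \<open>\<eta> / 2\<close> in norm. But \<open>inf u z\<^sub>n\<close> is disjoint and order bounded, so norm null.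
\<close>

lemma not_semi_compact_if_dominates_disjoint:
  fixes T :: "'a::banach_lattice \<Rightarrow>\<^sub>L 'b::banach_lattice"
    and x :: "nat \<Rightarrow> 'a" and z :: "nat \<Rightarrow> 'b"
  assumes ocn: "order_continuous_norm TYPE('b)"
    and x: "\<And>n. norm (x n) \<le> 1" and z: "\<And>n. 0 \<le> z n" "\<And>n. z n \<le> T (x n)"
    and disj: "\<And>m n. m \<noteq> n \<Longrightarrow> inf (z m) (z n) = 0"
    and \<eta>: "0 < \<eta>" "\<And>n. \<eta> \<le> norm (z n)"
  shows "\<not> semi_compact T"
proof
  assume "semi_compact T"
  then obtain u where u: "0 \<le> u"
    "T ` cball 0 1 \<subseteq> {y + (\<eta> / 2) *\<^sub>R b | y b. y \<in> {- u..u} \<and> b \<in> cball 0 1}"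
    using \<eta>(1) half_gt_zero unfolding semi_compact_def by blast
  have le: "norm (z n) \<le> norm (inf u (z n)) + \<eta> / 2" for n
  proof -
    have "T (x n) \<in> T ` cball 0 1" using x[of n] by simp
    then obtain y b where yb: "T (x n) = y + (\<eta> / 2) *\<^sub>R b" "y \<le> u" "norm b \<le> 1"
      using u(2) by auto
    let ?r = "\<bar>(\<eta> / 2) *\<^sub>R b\<bar>"
    have "z n \<le> u + ?r"
      using z(2)[of n] yb(1,2) by (metis abs_ge_self add_mono order_trans)
    then have "z n = inf (u + ?r) (z n)" by (simp add: inf_absorb2)
    also have "\<dots> \<le> inf u (z n) + inf ?r (z n)" by (intro inf_add_le u(1) z(1) abs_ge_zero)
    also have "\<dots> \<le> inf u (z n) + ?r" by simp
    finally have "norm (z n) \<le> norm (inf u (z n) + ?r)" by (rule norm_mono_nonneg[OF z(1)])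
    also have "\<dots> \<le> norm (inf u (z n)) + norm ((\<eta> / 2) *\<^sub>R b)"
      using norm_triangle_ineq[of _ ?r] by (simp del: norm_scaleR)
    also have "norm ((\<eta> / 2) *\<^sub>R b) \<le> \<eta> / 2" using yb(3) \<eta>(1) by simp
    finally show ?thesis by simp
  qed
  have "inf (inf u (z m)) (inf u (z n)) = 0" if "m \<noteq> n" for m n
    by (rule inf_eq_0_mono[OF disj[OF that]]) (use u(1) z(1) in auto)
  then have "(\<lambda>n. inf u (z n)) \<longlonglongrightarrow> 0"
    using u(1) z(1) by (intro order_continuous_disjoint_null[OF ocn, of _ u]) auto
  then have "(\<lambda>n. norm (inf u (z n)) + \<eta> / 2) \<longlonglongrightarrow> 0 + \<eta> / 2"
    by (intro tendsto_add tendsto_norm_zero tendsto_const)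
  moreover have "\<eta> \<le> norm (inf u (z n)) + \<eta> / 2" for n
    using le[of n] \<eta>(2)[of n] by simp
  ultimately have "\<eta> \<le> 0 + \<eta> / 2" by (intro LIMSEQ_le_const) auto
  then show False using \<eta>(1) by simp
qed

text \<open>
  The operator is \<open>T y = (\<Sum>n. g\<^sub>n(y) w\<^sub>n)\<close> with a disjoint sequence \<open>w\<^sub>n\<close> on which \<open>f\<close> does not
  tend to \<open>0\<close> and the components \<open>g\<^sub>n\<close> of \<open>f\<close> along the \<open>w\<^sub>n\<close>. It factors through \<open>\<ell>\<^sup>1\<close>.
\<close>

proposition exists_almost_L_weakly_compact_not_semi_compact:
  assumes ocn: "order_continuous_norm TYPE('a::banach_lattice)"
    and not_dual: "\<not> order_continuous_norm TYPE('a \<Rightarrow>\<^sub>L real)"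
  obtains T :: "'a::banach_lattice \<Rightarrow>\<^sub>L 'a" where "0 \<le> T" "almost_L_weakly_compact T" "\<not> semi_compact T"
proof -
  obtain f :: "'a \<Rightarrow>\<^sub>L real" and e where f: "0 \<le> f" and e: "0 < e"
    and fe: "\<not> (\<exists>u\<ge>0. \<forall>x\<ge>0. norm x \<le> 1 \<longrightarrow> f (pprt (x - u)) \<le> e)"
    using dual_order_continuous_if_order_bounded not_dual by blast
  have "e < norm (f (pprt x))" if "e < f (pprt x)" for x
    using that by simp
  then have "\<forall>u\<ge>0. \<exists>x\<ge>0. norm x \<le> 1 \<and> e < norm (f (pprt (x - u)))"
    using fe by (meson not_le)
  from disjoint_sequence_if_not_order_bounded[OF f e this]
  obtain w :: "nat \<Rightarrow> 'a" where w: "\<And>n. 0 \<le> w n" "\<And>n. norm (w n) \<le> 1"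
    "\<And>n. e / 2 < norm (f (w n))" "\<And>m n. m \<noteq> n \<Longrightarrow> inf (w m) (w n) = 0" by metis
  have fw: "e / 2 < f (w n)" for n using w(3)[of n] blinfun_nonneg[OF f w(1)[of n]] by simp
  obtain g :: "nat \<Rightarrow> 'a \<Rightarrow>\<^sub>L real" where g: "\<And>n. 0 \<le> g n" "\<And>n. f (w n) \<le> g n (w n)"
    "\<And>N y. 0 \<le> y \<Longrightarrow> (\<Sum>n<N. g n y) \<le> f y"
    by (rule functional_disjoint_components[of f w, OF f w(1) w(4)]) (assumption, rule that)
  obtain T :: "'a \<Rightarrow>\<^sub>L 'a" where T: "\<And>y. (\<lambda>n. g n y *\<^sub>R w n) sums T y"
    using dominated_functionals_series[of g f w, OF g(1,3) w(2)] by auto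
  have term_pos: "0 \<le> g n y *\<^sub>R w n" if "0 \<le> y" for n y
    using blinfun_nonneg[OF g(1) that] w(1) by (intro scaleR_nonneg_nonneg) auto
  have "0 \<le> T y" if "0 \<le> y" for y
    using lattice_suminf_nonneg[OF sums_summable[OF T[of y]] term_pos[OF that]]
    by (simp add: sums_unique[OF T[of y]])
  then have "0 \<le> T" by (simp add: less_eq_blinfun_def)
  moreover have "almost_L_weakly_compact T"
    by (rule series_operator_almost_L_weakly_compact[of g f w, OF ocn g(1,3) w(1,2) T])
  moreover have "\<not> semi_compact T"
  proof (rule not_semi_compact_if_dominates_disjoint[of w "\<lambda>n. (e / 2) *\<^sub>R w n", OF ocn w(2)])
    have "0 < norm f" using fw[of 0] e by auto
    show "0 < e / 2 * (e / 2 / norm f)" using e \<open>0 < norm f\<close> by simp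
    fix n
    show "0 \<le> (e / 2) *\<^sub>R w n" using e w(1) by (intro scaleR_nonneg_nonneg) auto
    have "(e / 2) *\<^sub>R w n \<le> g n (w n) *\<^sub>R w n"
      using fw[of n] g(2)[of n] w(1)[of n] by (intro scaleR_right_mono) auto
    also have "\<dots> \<le> T (w n)"
      using lattice_member_le_suminf[OF sums_summable[OF T[of "w n"]] term_pos[OF w(1)]]
      by (simp add: sums_unique[OF T[of "w n"]])
    finally show "(e / 2) *\<^sub>R w n \<le> T (w n)" .
    have "e / 2 \<le> norm f * norm (w n)" using fw[of n] norm_blinfun[of f "w n"] by simp
    then have "e / 2 / norm f \<le> norm (w n)" using \<open>0 < norm f\<close> by (simp add: field_simps)
    then have "e / 2 * (e / 2 / norm f) \<le> e / 2 * norm (w n)" using e by (intro mult_left_mono) auto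
    then show "e / 2 * (e / 2 / norm f) \<le> norm ((e / 2) *\<^sub>R w n)" using e by simp
    fix m assume "m \<noteq> n"
    then show "inf ((e / 2) *\<^sub>R w m) ((e / 2) *\<^sub>R w n) = 0"
      using scaleR_inf[of "e / 2" "w m" "w n"] w(4)[of m n] e by simp
  qed
  ultimately show thesis by (rule that)
qed

section \<open>The characterization\<close>

theorem theorem2p3:
  assumes "order_continuous_norm TYPE('a::banach_lattice)"
  shows "(\<forall>T :: 'a \<Rightarrow>\<^sub>L 'a. 0 \<le> T \<longrightarrow> almost_L_weakly_compact T \<longrightarrow> semi_compact T) \<longleftrightarrow>
    order_continuous_norm TYPE('a \<Rightarrow>\<^sub>L real)"
proof
  assume *: "\<forall>T :: 'a \<Rightarrow>\<^sub>L 'a. 0 \<le> T \<longrightarrow> almost_L_weakly_compact T \<longrightarrow> semi_compact T"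
  show "order_continuous_norm TYPE('a \<Rightarrow>\<^sub>L real)"
  proof (rule ccontr)
    assume "\<not> order_continuous_norm TYPE('a \<Rightarrow>\<^sub>L real)"
    then obtain T :: "'a \<Rightarrow>\<^sub>L 'a" where "0 \<le> T" "almost_L_weakly_compact T" "\<not> semi_compact T"
      by (rule exists_almost_L_weakly_compact_not_semi_compact[OF assms])
    with * show False by simp
  qed
next
  assume "order_continuous_norm TYPE('a \<Rightarrow>\<^sub>L real)"
  then show "\<forall>T :: 'a \<Rightarrow>\<^sub>L 'a. 0 \<le> T \<longrightarrow> almost_L_weakly_compact T \<longrightarrow> semi_compact T"
    by (intro allI impI almost_L_weakly_compact_imp_semi_compact[OF assms])
qed

end
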